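(* For every positive integer $k$, the problem $k$-TMF belongs to NP.
   Context: The tropical semiring is $\mathbb{R}$ with $a\oplus b=\min\{a,b\}$ and $a\otimes b=a+b$; $(B\otimes C)_{ij}=\min_{\tau}\{B_{i\tau}+C_{\tau j}\}$. The problem $k$-TMF: given $A\in\mathbb{Z}^{m\times n}$ (written as an array of integers in decimal notation, input size $\sum_{i,j}[\log_{10}\max\{|A_{ij}|,1\}]+3mn$), decide whether there exist $B\in\mathbb{R}^{m\times k}$ and $C\in\mathbb{R}^{k\times n}$ with $B\otimes C=A$. *)

theory Defs
  imports
    "HOL-Computational_Algebra.Polynomial"
    "HOL-Library.Log_Nat"
    "Jordan_Normal_Form.Matrix"
begin

section \<open>Multi-tape Turing machines\<close>

text \<open>
  Tape symbols over an input alphabet \<open>'a\<close>. \<open>Bit\<close> symbols spell certificates; \<open>Work\<close> supplies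
  further symbols, of which every machine uses only finitely many. Tapes are infinite in both
  directions.
\<close>

datatype 'a symbol = Blank | Inp 'a | Bit bool | Work nat

datatype direction = Left | Stay | Right

datatype 'a tape = Tape (cells: "int \<Rightarrow> 'a symbol") (head: int)

definition word_tape :: "'a symbol list \<Rightarrow> 'a tape" where
  "word_tape w =
     Tape (\<lambda>i. if 0 \<le> i \<and> i < int (length w) then w ! nat i else Blank) 0"

fun move_head :: "direction \<Rightarrow> int \<Rightarrow> int" where
  "move_head Left i = i - 1"
| "move_head Stay i = i"
| "move_head Right i = i + 1"

fun act :: "'a symbol \<times> direction \<Rightarrow> 'a tape \<Rightarrow> 'a tape" where
  "act (s, d) (Tape c h) = Tape (c(h := s)) (move_head d h)"

record 'a tm =
  tape_count :: nat
  states :: "nat set"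
  alphabet :: "'a symbol set"
  start_state :: nat
  accept_state :: nat
  reject_state :: nat
  trans :: "nat \<Rightarrow> 'a symbol list \<Rightarrow> nat \<times> ('a symbol \<times> direction) list"

definition halt_states :: "'a tm \<Rightarrow> nat set" where
  "halt_states M = {accept_state M, reject_state M}"

definition turing_machine :: "'a::finite tm \<Rightarrow> bool" where
  "turing_machine M \<longleftrightarrow>
     tape_count M \<ge> 2 \<and>
     finite (states M) \<and> start_state M \<in> states M \<and> halt_states M \<subseteq> states M \<and>
     accept_state M \<noteq> reject_state M \<and>
     finite (alphabet M) \<and> {Blank} \<union> range Inp \<union> range Bit \<subseteq> alphabet M \<and>
     (\<forall>q \<in> states M - halt_states M. \<forall>ss. length ss = tape_count M \<and> set ss \<subseteq> alphabet M \<longrightarrow>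
        (case trans M q ss of (q', as) \<Rightarrow>
           q' \<in> states M \<and> length as = tape_count M \<and> fst ` set as \<subseteq> alphabet M))"

type_synonym 'a config = "nat \<times> 'a tape list"

definition step :: "'a tm \<Rightarrow> 'a config \<Rightarrow> 'a config" where
  "step M = (\<lambda>(q, ts).
     if q \<in> halt_states M then (q, ts)
     else case trans M q (map (\<lambda>t. cells t (head t)) ts) of
            (q', as) \<Rightarrow> (q', map2 act as ts))"

text \<open>The input is on the first tape, the certificate on the second; the other tapes are blank.\<close>

definition start_config :: "'a tm \<Rightarrow> 'a list \<Rightarrow> bool list \<Rightarrow> 'a config" where
  "start_config M x u =
     (start_state M,
      [word_tape (map Inp x), word_tape (map Bit u)] @
      replicate (tape_count M - 2) (word_tape []))"

definition state_after :: "'a tm \<Rightarrow> 'a list \<Rightarrow> bool list \<Rightarrow> nat \<Rightarrow> nat" where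
  "state_after M x u t = fst ((step M ^^ t) (start_config M x u))"

definition accepts :: "'a tm \<Rightarrow> 'a list \<Rightarrow> bool list \<Rightarrow> bool" where
  "accepts M x u \<longleftrightarrow> (\<exists>t. state_after M x u t = accept_state M)"

definition polynomial_time :: "'a tm \<Rightarrow> bool" where
  "polynomial_time M \<longleftrightarrow>
     (\<exists>p :: nat poly. \<forall>x u. state_after M x u (poly p (length x + length u)) \<in> halt_states M)"


section \<open>The class NP\<close>

definition NP :: "'a::finite list set set" where
  "NP = {L. \<exists>M. turing_machine M \<and> polynomial_time M \<and>
     (\<exists>p :: nat poly. \<forall>x. x \<in> L \<longleftrightarrow>
        (\<exists>u. length u \<le> poly p (length x) \<and> accepts M x u))}"


section \<open>Tropical matrix factorization\<close>

text \<open>The minimum is over a nonempty set only if \<open>dim_col B > 0\<close>.\<close>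

definition trop_mult :: "real mat \<Rightarrow> real mat \<Rightarrow> real mat" (infixl "\<otimes>\<^sub>T" 70) where
  "B \<otimes>\<^sub>T C = mat (dim_row B) (dim_col C)
     (\<lambda>(i, j). Min ((\<lambda>\<tau>. B $$ (i, \<tau>) + C $$ (\<tau>, j)) ` {..<dim_col B}))"

definition has_trop_factorization :: "nat \<Rightarrow> int mat \<Rightarrow> bool" where
  "has_trop_factorization k A \<longleftrightarrow>
     (\<exists>B \<in> carrier_mat (dim_row A) k. \<exists>C \<in> carrier_mat k (dim_col A).
        B \<otimes>\<^sub>T C = map_mat real_of_int A)"

fun decimal :: "nat \<Rightarrow> string" where
  "decimal n =
     (if n < 10 then [''0123456789'' ! n]
      else decimal (n div 10) @ [''0123456789'' ! (n mod 10)])"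

declare decimal.simps [simp del]

definition encode_int :: "int \<Rightarrow> string" where
  "encode_int a = (if a < 0 then ''-'' else ''+'') @ decimal (nat \<bar>a\<bar>)"

text \<open>
  Rows are written one after another; an entry is followed by a comma, and by a semicolon if it
  is the last one of its row. For example, the matrix with rows \<open>(12, -3)\<close> and \<open>(0, 7)\<close> becomes
  \<open>+12,-3;+0,+7;\<close>.
\<close>

definition encode_matrix :: "int mat \<Rightarrow> string" where
  "encode_matrix A =
     concat (map (\<lambda>i.
       concat (map (\<lambda>j. encode_int (A $$ (i, j)) @ (if Suc j = dim_col A then '';'' else '',''))
         [0..<dim_col A]))
       [0..<dim_row A])"

lemma length_decimal: "length (decimal n) = nat \<lfloor>log 10 (real (max n 1))\<rfloor> + 1"
proof (induction n rule: decimal.induct)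
  case (1 n)
  show ?case
  proof (cases "n < 10")
    case True
    have "\<lfloor>log 10 (real (max n 1))\<rfloor> = 0"
      using True by (simp add: floor_eq_iff log_less_iff)
    then show ?thesis using True by (simp add: decimal.simps)
  next
    case False
    have "\<lfloor>log 10 (real n)\<rfloor> = \<lfloor>log 10 (real (n div 10))\<rfloor> + 1"
      using floor_log_div[of 10 n] False by simp
    moreover have "0 \<le> \<lfloor>log 10 (real (n div 10))\<rfloor>"
      using False by simp
    moreover have "max n 1 = n" "max (n div 10) 1 = n div 10"
      using False by (auto simp: max_def)
    ultimately show ?thesis using False 1 by (subst decimal.simps) (simp add: nat_add_distrib)
  qed
qed

text \<open>
  The length of the encoding is exactly the input size
  \<open>\<Sum>i j. \<lfloor>log 10 (max \<bar>A i j\<bar> 1)\<rfloor> + 3 * m * n\<close>.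
\<close>

lemma length_encode_matrix:
  "length (encode_matrix A) =
     (\<Sum>i<dim_row A. \<Sum>j<dim_col A. nat \<lfloor>log 10 (real_of_int (max \<bar>A $$ (i, j)\<bar> 1))\<rfloor>) +
     3 * dim_row A * dim_col A"
proof -
  have e: "length (encode_int a) = nat \<lfloor>log 10 (real_of_int (max \<bar>a\<bar> 1))\<rfloor> + 2" for a
  proof -
    have "real (max (nat \<bar>a\<bar>) 1) = real_of_int (max \<bar>a\<bar> 1)" by linarith
    then show ?thesis by (simp add: encode_int_def length_decimal)
  qed
  have "length (encode_int (A $$ (i, j)) @ (if b then '';'' else '','')) =
          nat \<lfloor>log 10 (real_of_int (max \<bar>A $$ (i, j)\<bar> 1))\<rfloor> + 3" for i j b
    by (simp add: e)
  then show ?thesis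
    by (simp add: encode_matrix_def length_concat comp_def sum.distrib
        interv_sum_list_conv_sum_set_nat atLeast0LessThan del: length_append add_Suc_right)
qed

text \<open>Strings that do not encode a matrix are no-instances.\<close>

definition TMF :: "nat \<Rightarrow> string set" where
  "TMF k = {encode_matrix A | A. dim_row A > 0 \<and> dim_col A > 0 \<and> has_trop_factorization k A}"

end

theory Submission
  imports Defs "HOL-Library.Countable"
begin

text \<open>
  The certificate spells a word over a finite alphabet of tiles, and everything to be verified is
  local: a condition on each letter, its successor, and the letters at two guessed distances \<open>d\<close> and
  \<open>e\<close> before it. A machine checks this by pushing the word onto three tapes, shifting two of the
  heads back by \<open>d\<close> and \<open>e\<close>, and scanning.

  The word writes each entry \<open>A i j\<close> of the matrix in a cell of fixed width \<open>d\<close>, together with the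
  digits of \<open>B i \<tau>\<close> and \<open>C \<tau> j\<close> for all \<open>\<tau> < k\<close>; a row has width \<open>e\<close>. The copies of \<open>B i \<tau>\<close> are
  compared at distance \<open>d\<close> and those of \<open>C \<tau> j\<close> at distance \<open>e\<close>. The sign of \<open>B i \<tau> + C \<tau> j - A i j\<close>
  is found by Horner's scheme, most significant digit first, whose value may be clamped to
  \<open>{-3..3}\<close>.

  Short certificates exist: the floors of \<open>B\<close> and \<open>-C\<close> for a real solution again give a solution, and
  so they do after all gaps between these integers have been shrunk to at most \<open>max \<bar>A i j\<bar>\<close>.
\<close>

section \<open>Locally checkable certificates\<close>

text \<open>Positions are integers and the value is optional because heads may leave the word on
  either side, where they read a blank.\<close>

definition letter :: "'b list \<Rightarrow> int \<Rightarrow> 'b option" where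
  "letter w i = (if 0 \<le> i \<and> i < int (length w) then Some (w ! nat i) else None)"

text \<open>Position -1 is included so that the first letter, too, is constrained as a successor; at
  the last position the successor is \<open>None\<close>.\<close>

definition locally_valid ::
    "('b option \<Rightarrow> 'b option \<Rightarrow> 'b option \<Rightarrow> 'b option \<Rightarrow> bool) \<Rightarrow> 'b list \<Rightarrow> nat \<Rightarrow> nat \<Rightarrow> bool" where
  "locally_valid Q w d e \<longleftrightarrow> (\<forall>p\<in>{-1..<int (length w)}.
     Q (letter w (p + 1)) (letter w p) (letter w (p - int d)) (letter w (p - int e)))"

lemma letter_int [simp]: "i < length w \<Longrightarrow> letter w (int i) = Some (w ! i)"
  by (simp add: letter_def)

lemma letter_None_iff: "letter w i = None \<longleftrightarrow> i < 0 \<or> int (length w) \<le> i"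
  by (auto simp: letter_def)

lemma letter_map: "letter (map f w) i = map_option f (letter w i)"
  by (auto simp: letter_def nat_less_iff)

lemma letter_drop:
  assumes "letter w p = Some c"
  shows "0 \<le> p" "p < int (length w)" "drop (nat p) w = c # drop (nat (p + 1)) w"
proof -
  show p: "0 \<le> p" "p < int (length w)"
    using assms by (auto simp: letter_def split: if_splits)
  have "drop (nat p) w = w ! nat p # drop (Suc (nat p)) w"
    using p by (intro Cons_nth_drop_Suc [symmetric]) linarith
  moreover have "Suc (nat p) = nat (p + 1)" using p by simp
  moreover have "w ! nat p = c" using assms p by (simp add: letter_def)
  ultimately show "drop (nat p) w = c # drop (nat (p + 1)) w" by metis
qed

section \<open>The verifying machine\<close>

datatype phase = Push nat | Shift1 | Shift2 | Seek | Check "nat option" | Acc | Rej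

instance phase :: countable
  by countable_datatype

text \<open>The phase, the word pushed so far, the input head and the heads on the three work tapes.
  One word describes all three tapes, as they receive the same symbols. Until the machine halts, the
  certificate head is at the number of steps made.\<close>

type_synonym verifier_config = "phase \<times> nat list \<times> int \<times> int \<times> int \<times> int"

fun bit_of :: "'a symbol \<Rightarrow> bool option" where
  "bit_of (Bit b) = Some b" | "bit_of _ = None"

fun inp_of :: "'a symbol \<Rightarrow> 'a option" where
  "inp_of (Inp a) = Some a" | "inp_of _ = None"

fun work_of :: "'a symbol \<Rightarrow> nat option" where
  "work_of (Work c) = Some c" | "work_of _ = None"

locale local_verifier =
  fixes K :: nat and emit :: "nat \<Rightarrow> 'a::finite option"
    and Q :: "nat option \<Rightarrow> nat option \<Rightarrow> nat option \<Rightarrow> nat option \<Rightarrow> bool"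
begin

text \<open>
  Every step consumes one certificate bit, which makes the running time trivially linear. The
  bits \<open>1\<^sup>c 0\<close> push the symbol \<open>c < K\<close> onto the three work tapes, and \<open>1\<^sup>K 0\<close> ends this phase.
  The heads of the last two work tapes are then moved back by the distances the certificate
  dictates, the input head is moved to the end of the input, and everything is read from right
  to left.
\<close>

fun \<delta> :: "phase \<Rightarrow> bool option \<Rightarrow> 'a option \<Rightarrow> nat option \<Rightarrow> nat option \<Rightarrow> nat option \<Rightarrow>
    phase \<times> nat option \<times> direction \<times> direction \<times> direction \<times> direction" where
  "\<delta> Acc _ _ _ _ _ = (Acc, None, Stay, Stay, Stay, Stay)"
| "\<delta> Rej _ _ _ _ _ = (Rej, None, Stay, Stay, Stay, Stay)"
| "\<delta> _ None _ _ _ _ = (Rej, None, Stay, Stay, Stay, Stay)"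
| "\<delta> (Push c) (Some True) _ _ _ _ =
     (if c < K then Push (Suc c) else Rej, None, Stay, Stay, Stay, Stay)"
| "\<delta> (Push c) (Some False) _ _ _ _ =
     (if c < K then (Push 0, Some c, Stay, Right, Right, Right)
      else (Shift1, None, Stay, Left, Left, Left))"
| "\<delta> Shift1 (Some b) _ _ _ _ =
     (if b then (Shift1, None, Stay, Stay, Left, Stay) else (Shift2, None, Stay, Stay, Stay, Stay))"
| "\<delta> Shift2 (Some b) _ _ _ _ =
     (if b then (Shift2, None, Stay, Stay, Stay, Left) else (Seek, None, Stay, Stay, Stay, Stay))"
| "\<delta> Seek (Some b) a _ _ _ =
     (if a = None then (Check None, None, Left, Stay, Stay, Stay)
      else (Seek, None, Right, Stay, Stay, Stay))"
| "\<delta> (Check r) (Some b) a s1 s2 s3 =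
     (if \<not> Q r s1 s2 s3 then (Rej, None, Stay, Stay, Stay, Stay)
      else case s1 of
        None \<Rightarrow> (if a = None then Acc else Rej, None, Stay, Stay, Stay, Stay)
      | Some c \<Rightarrow>
          (case emit c of
             None \<Rightarrow> (Check s1, None, Stay, Left, Left, Left)
           | Some e \<Rightarrow> if a = Some e then (Check s1, None, Left, Left, Left, Left)
                       else (Rej, None, Stay, Stay, Stay, Stay)))"

text \<open>Appending models writing at the heads: symbols are written only in \<open>Push\<close>,
  where all three heads stand just behind the word.\<close>

fun vstep :: "'a list \<Rightarrow> bool option \<Rightarrow> verifier_config \<Rightarrow> verifier_config" where
  "vstep x b (q, w, i, h1, h2, h3) =
     (case \<delta> q b (letter x i) (letter w h1) (letter w h2) (letter w h3) of
        (q', wr, d0, d1, d2, d3) \<Rightarrow>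
          (q', w @ (case wr of None \<Rightarrow> [] | Some c \<Rightarrow> [c]),
           move_head d0 i, move_head d1 h1, move_head d2 h2, move_head d3 h3))"

definition M :: "'a tm" where
  "M = \<lparr>tape_count = 5,
        states = to_nat ` (Push ` {..K} \<union> {Shift1, Shift2, Seek, Acc, Rej} \<union>
                           Check ` ({None} \<union> Some ` {..<K})),
        alphabet = {Blank} \<union> range Inp \<union> range Bit \<union> Work ` {..<K},
        start_state = to_nat (Push 0),
        accept_state = to_nat Acc,
        reject_state = to_nat Rej,
        trans = \<lambda>q ss.
          case \<delta> (from_nat q) (bit_of (ss ! 1)) (inp_of (ss ! 0))
                 (work_of (ss ! 2)) (work_of (ss ! 3)) (work_of (ss ! 4)) of
            (q', wr, d0, d1, d2, d3) \<Rightarrow>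
              (to_nat q', [(ss ! 0, d0), (ss ! 1, Right),
                 (case wr of None \<Rightarrow> ss ! 2 | Some c \<Rightarrow> Work c, d1),
                 (case wr of None \<Rightarrow> ss ! 3 | Some c \<Rightarrow> Work c, d2),
                 (case wr of None \<Rightarrow> ss ! 4 | Some c \<Rightarrow> Work c, d3)])\<rparr>"

lemma halt_states_M: "to_nat q \<in> halt_states M \<longleftrightarrow> q \<in> {Acc, Rej}"
  by (auto simp: M_def halt_states_def)

text \<open>Keeps states and alphabet finite. Among the letters read, only \<open>s1\<close> can
  enter the new state: \<open>Check\<close> remembers it as the successor for the next test.\<close>

lemma \<delta>_state:
  assumes "\<delta> q b a s1 s2 s3 = (q', wr, ds)"
    and "q \<in> Push ` {..K} \<union> {Shift1, Shift2, Seek, Acc, Rej} \<union> Check ` ({None} \<union> Some ` {..<K})"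
    and "\<And>c. s1 = Some c \<Longrightarrow> c < K"
  shows "q' \<in> Push ` {..K} \<union> {Shift1, Shift2, Seek, Acc, Rej} \<union> Check ` ({None} \<union> Some ` {..<K})"
    and "\<And>c. wr = Some c \<Longrightarrow> c < K"
  using assms
  by (induction q b a s1 s2 s3 rule: \<delta>.induct)
     (auto split: if_splits option.splits)

lemma accept_state_M: "accept_state M = to_nat Acc"
  by (simp add: M_def)

lemma turing_machine_M: "turing_machine M"
proof -
  let ?P = "Push ` {..K} \<union> {Shift1, Shift2, Seek, Acc, Rej} \<union> Check ` ({None} \<union> Some ` {..<K})"
  have trans: "case trans M q ss of (q', as) \<Rightarrow>
      q' \<in> states M \<and> length as = tape_count M \<and> fst ` set as \<subseteq> alphabet M"
    if q: "q \<in> states M" and ss: "length ss = tape_count M" "set ss \<subseteq> alphabet M" for q ss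
  proof -
    obtain r where r: "q = to_nat r" "r \<in> ?P" using q by (auto simp: M_def)
    have al: "ss ! i \<in> alphabet M" if "i < 5" for i
    proof -
      have "ss ! i \<in> set ss" using ss that by (intro nth_mem) (simp add: M_def)
      then show ?thesis using ss by blast
    qed
    obtain q' wr d0 d1 d2 d3 where d: "\<delta> r (bit_of (ss ! 1)) (inp_of (ss ! 0))
        (work_of (ss ! 2)) (work_of (ss ! 3)) (work_of (ss ! 4)) = (q', wr, d0, d1, d2, d3)"
      by (metis surj_pair)
    have "c < K" if "work_of (ss ! 2) = Some c" for c
      using al[of 2] that by (cases "ss ! 2") (auto simp: M_def)
    note s = \<delta>_state[OF d r(2) this]
    have "(case wr of None \<Rightarrow> ss ! i | Some c \<Rightarrow> Work c) \<in> alphabet M" if "i < 5" for i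
      using al[OF that] s(2) by (auto simp: M_def split: option.splits)
    from this[of 2] this[of 3] this[of 4] s(1) al[of 0] al[of 1] show ?thesis
      unfolding M_def by (simp add: r d inj_image_mem_iff del: One_nat_def)
  qed
  show ?thesis
    unfolding turing_machine_def
  proof (intro conjI ballI allI impI)
    show "finite (states M)" "finite (alphabet M)" "2 \<le> tape_count M" "start_state M \<in> states M"
      "halt_states M \<subseteq> states M" "accept_state M \<noteq> reject_state M"
      "{Blank} \<union> range Inp \<union> range Bit \<subseteq> alphabet M"
      by (auto simp: M_def halt_states_def)
    fix q ss
    assume "q \<in> states M - halt_states M" "length ss = tape_count M \<and> set ss \<subseteq> alphabet M"
    then show "case trans M q ss of (q', as) \<Rightarrow>
        q' \<in> states M \<and> length as = tape_count M \<and> fst ` set as \<subseteq> alphabet M"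
      by (intro trans) auto
  qed
qed

section \<open>Runs, simulation and soundness\<close>

definition vrun :: "'a list \<Rightarrow> bool list \<Rightarrow> nat \<Rightarrow> verifier_config" where
  "vrun x u t = fold (vstep x) (map (\<lambda>i. letter u (int i)) [0..<t]) (Push 0, [], 0, 0, 0, 0)"

lemma vrun_0: "vrun x u 0 = (Push 0, [], 0, 0, 0, 0)"
  by (simp add: vrun_def)

lemma vrun_Suc: "vrun x u (Suc t) = vstep x (letter u (int t)) (vrun x u t)"
  by (simp add: vrun_def)

lemma vrun_length: "vrun x u (length u) = fold (vstep x) (map Some u) (Push 0, [], 0, 0, 0, 0)"
proof -
  have "map (\<lambda>i. letter u (int i)) [0..<length u] = map Some u"
    by (rule nth_equalityI) auto
  then show ?thesis by (simp add: vrun_def)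
qed

lemma vstep_halted: "q \<in> {Acc, Rej} \<Longrightarrow> vstep x b (q, w) = (q, w)"
  by (cases w) auto

lemma vstep_None: "fst (vstep x None c) \<in> {Acc, Rej}"
  by (cases c; cases "fst c") auto

text \<open>In \<open>Check\<close> the three heads move in lockstep, so \<open>h1 - h2\<close> and
  \<open>h1 - h3\<close> remain the guessed distances. What lies right of \<open>h1\<close> has
  passed \<open>Q\<close> and has emitted the input right of \<open>i\<close>.\<close>

definition Inv :: "'a list \<Rightarrow> verifier_config \<Rightarrow> bool" where
  "Inv x = (\<lambda>(q, w, i, h1, h2, h3).
     let n = int (length w) in set w \<subseteq> {..<K} \<and>
     (case q of
        Push c \<Rightarrow> i = 0 \<and> h1 = n \<and> h2 = n \<and> h3 = n
      | Shift1 \<Rightarrow> i = 0 \<and> h1 = n - 1 \<and> h2 \<le> n - 1 \<and> h3 = n - 1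
      | Shift2 \<Rightarrow> i = 0 \<and> h1 = n - 1 \<and> h2 \<le> n - 1 \<and> h3 \<le> n - 1
      | Seek \<Rightarrow> 0 \<le> i \<and> i \<le> int (length x) \<and> h1 = n - 1 \<and> h2 \<le> n - 1 \<and> h3 \<le> n - 1
      | Check r \<Rightarrow>
          r = letter w (h1 + 1) \<and> - 1 \<le> h1 \<and> h1 < n \<and> h2 \<le> h1 \<and> h3 \<le> h1 \<and>
          - 1 \<le> i \<and> i < int (length x) \<and>
          List.map_filter emit (drop (nat (h1 + 1)) w) = drop (nat (i + 1)) x \<and>
          (\<forall>p. h1 < p \<longrightarrow> p < n \<longrightarrow>
             Q (letter w (p + 1)) (letter w p) (letter w (p - (h1 - h2))) (letter w (p - (h1 - h3))))
      | Acc \<Rightarrow> List.map_filter emit w = x \<and> (\<exists>d e. locally_valid Q w d e)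
      | Rej \<Rightarrow> True))"

lemma Inv_Push: "Inv x (Push c, w, i, h1, h2, h3) \<longleftrightarrow>
    set w \<subseteq> {..<K} \<and> i = 0 \<and> h1 = int (length w) \<and> h2 = int (length w) \<and> h3 = int (length w)"
  by (simp add: Inv_def Let_def)

text \<open>A passed test extends the verified part of the word by one position and, if the letter
  emits, the matched part of the input by one symbol. \<open>Acc\<close> is entered only with both
  heads at -1, when nothing is left to verify or to match.\<close>

lemma Inv_Check_step:
  assumes I: "Inv x (Check r, w, i, h1, h2, h3)"
  shows "Inv x (vstep x (Some b) (Check r, w, i, h1, h2, h3))"
proof -
  let ?n = "int (length w)"
  let ?Q = "\<lambda>p. Q (letter w (p + 1)) (letter w p) (letter w (p - (h1 - h2))) (letter w (p - (h1 - h3)))"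
  from I have w: "set w \<subseteq> {..<K}" and r: "r = letter w (h1 + 1)" and h: "-1 \<le> h1" "h1 < ?n" "h2 \<le> h1" "h3 \<le> h1"
    and i: "-1 \<le> i" "i < int (length x)"
    and em: "List.map_filter emit (drop (nat (h1 + 1)) w) = drop (nat (i + 1)) x"
    and q: "\<And>p. h1 < p \<Longrightarrow> p < ?n \<Longrightarrow> ?Q p"
    by (auto simp: Inv_def Let_def)
  have rej: "Inv x (Rej, w, i, h1, h2, h3)" using w by (simp add: Inv_def)
  show ?thesis
  proof (cases "Q r (letter w h1) (letter w h2) (letter w h3)")
    case False
    then show ?thesis using rej by simp
  next
    case True
    then have "?Q h1" by (simp add: r)
    then have q': "?Q p" if "h1 \<le> p" "p < ?n" for p
      using q[of p] that by (cases "p = h1") auto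
    show ?thesis
    proof (cases "letter w h1")
      case None
      then have h1: "h1 = -1" using h by (simp add: letter_None_iff)
      show ?thesis
      proof (cases "letter x i")
        case a: None
        then have "i = -1" using i by (simp add: letter_None_iff)
        then have "List.map_filter emit w = x" using em h1 by simp
        moreover have "locally_valid Q w (nat (h1 - h2)) (nat (h1 - h3))"
          unfolding locally_valid_def using q' h h1 by auto
        ultimately have "Inv x (Acc, w, i, h1, h2, h3)" using w by (auto simp: Inv_def)
        then show ?thesis using True None a by simp
      next
        case (Some a)
        then show ?thesis using True None rej by simp
      qed
    next
      case c: (Some c)
      \<comment> \<open>Brings \<open>letter_drop\<close> into the shape that the invariant takes
        after the head has moved left.\<close>
      have "nat (h1 - 1 + 1) = nat h1" by simp
      note d = letter_drop[OF c, folded this]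
      show ?thesis
      proof (cases "emit c")
        case None
        then have "Inv x (Check (Some c), w, i, h1 - 1, h2 - 1, h3 - 1)"
          using w h i em q' c d by (auto simp: Inv_def List.map_filter_def)
        then show ?thesis using True c None by simp
      next
        case e: (Some e)
        show ?thesis
        proof (cases "letter x i = Some e")
          case True': True
          have "nat (i - 1 + 1) = nat i" by simp
          note d' = letter_drop[OF True', folded this]
          from e have "Inv x (Check (Some c), w, i - 1, h1 - 1, h2 - 1, h3 - 1)"
            using w h i em q' c d d' by (auto simp: Inv_def List.map_filter_def)
          then show ?thesis using True True' c e by simp
        next
          case False
          then show ?thesis using True c e rej by simp
        qed
      qed
    qed
  qed
qed

lemma Inv_step:
  assumes "Inv x c"
  shows "Inv x (vstep x b c)"
proof -
  obtain q w i h1 h2 h3 where c: "c = (q, w, i, h1, h2, h3)" by (metis surj_pair)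
  show ?thesis
  proof (cases b)
    case None
    then show ?thesis using assms unfolding c by (cases q) (auto simp: Inv_def Let_def)
  next
    case (Some b')
    show ?thesis
    proof (cases q)
      case (Check r)
      then show ?thesis using Inv_Check_step assms c Some by simp
    next
      \<comment> \<open>When \<open>Seek\<close> ends, the input head steps back from the first
        blank and \<open>h1\<close> is at \<open>n - 1\<close>: both verified suffixes are
        empty.\<close>
      case Seek
      then show ?thesis using assms unfolding c Some
        by (auto simp: Inv_def Let_def letter_None_iff letter_def[of w] List.map_filter_def
              split: if_splits)
    qed (use assms in \<open>cases b'; auto simp: c Some Inv_def Let_def\<close>)+
  qed
qed

lemma Inv_vrun: "Inv x (vrun x u t)"
  by (induction t) (auto simp: vrun_0 vrun_Suc Inv_step, simp add: Inv_def)

definition tapes :: "'a list \<Rightarrow> bool list \<Rightarrow> nat \<Rightarrow> verifier_config \<Rightarrow> 'a tape list" where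
  "tapes x u t = (\<lambda>(q, w, i, h1, h2, h3).
     let c = cells (word_tape (map Work w)) in
     [Tape (cells (word_tape (map Inp x))) i, Tape (cells (word_tape (map Bit u))) (int t),
      Tape c h1, Tape c h2, Tape c h3])"

lemma cells_word_tape: "cells (word_tape w) i = (case letter w i of None \<Rightarrow> Blank | Some s \<Rightarrow> s)"
  by (auto simp: word_tape_def letter_def)

lemma cells_word_tape_snoc:
  "(cells (word_tape w))(int (length w) := s) = cells (word_tape (w @ [s]))"
  by (auto simp: word_tape_def nth_append fun_eq_iff nat_less_iff)

lemma of_cells:
  "inp_of (cells (word_tape (map Inp x)) i) = letter x i"
  "bit_of (cells (word_tape (map Bit u)) i) = letter u i"
  "work_of (cells (word_tape (map Work w)) i) = letter w i"
  by (simp_all add: cells_word_tape letter_map split: option.splits)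

text \<open>Together with \<open>Inv_Push\<close> this shows that every write takes place at the end
  of the word.\<close>

lemma \<delta>_write: "\<delta> q b a s1 s2 s3 = (q', Some c, ds) \<Longrightarrow> \<exists>c. q = Push c"
  by (induction q b a s1 s2 s3 rule: \<delta>.induct) (auto split: if_splits option.splits)

lemma step_M:
  assumes I: "Inv x c" and c: "fst c \<notin> {Acc, Rej}"
  shows "step M (to_nat (fst c), tapes x u t c) =
    (to_nat (fst (vstep x (letter u (int t)) c)), tapes x u (Suc t) (vstep x (letter u (int t)) c))"
proof -
  obtain q w i h1 h2 h3 where cc: "c = (q, w, i, h1, h2, h3)" by (metis surj_pair)
  obtain q' wr d0 d1 d2 d3
    where d: "\<delta> q (letter u (int t)) (letter x i) (letter w h1) (letter w h2) (letter w h3) =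
      (q', wr, d0, d1, d2, d3)"
    by (metis surj_pair)
  have nh: "to_nat q \<notin> halt_states M" using c cc halt_states_M[of q] by simp
  show ?thesis
  proof (cases wr)
    case None
    then show ?thesis
      using nh by (simp add: cc step_def tapes_def Let_def M_def of_cells d add.commute)
  next
    case (Some s)
    then obtain c' where "q = Push c'" using \<delta>_write d by blast
    then have "h1 = int (length w)" "h2 = int (length w)" "h3 = int (length w)"
      using I cc Inv_Push by auto
    moreover have "(cells (word_tape (map Work w)))(int (length w) := Work s) =
        cells (word_tape (map Work (w @ [s])))"
      using cells_word_tape_snoc[of "map Work w"] by simp
    ultimately show ?thesis
      using Some nh d
      by (simp add: cc step_def tapes_def Let_def M_def of_cells add.commute)
  qed
qed

text \<open>The tapes are compared only before halting: a halted machine is frozen, whereas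
  \<open>tapes\<close> moves the certificate head on with \<open>t\<close>.\<close>

lemma config_vrun:
  "fst ((step M ^^ t) (start_config M x u)) = to_nat (fst (vrun x u t)) \<and>
   (fst (vrun x u t) \<notin> {Acc, Rej} \<longrightarrow>
     snd ((step M ^^ t) (start_config M x u)) = tapes x u t (vrun x u t))"
proof (induction t)
  case 0
  show ?case
    unfolding vrun_0 tapes_def Let_def list.map prod.case
    by (simp add: start_config_def M_def word_tape_def numeral_eq_Suc)
next
  case (Suc t)
  let ?C = "(step M ^^ t) (start_config M x u)"
  show ?case
  proof (cases "fst (vrun x u t) \<in> {Acc, Rej}")
    case True
    moreover have "step M ?C = ?C"
      using Suc True halt_states_M by (cases ?C) (auto simp: step_def)
    ultimately show ?thesis
      using Suc vstep_halted[of "fst (vrun x u t)" x _ "snd (vrun x u t)"] by (simp add: vrun_Suc)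
  next
    case False
    then have "?C = (to_nat (fst (vrun x u t)), tapes x u t (vrun x u t))"
      using Suc by (simp add: prod_eq_iff)
    then show ?thesis using step_M[OF Inv_vrun False] by (simp add: vrun_Suc)
  qed
qed

lemma state_after_M: "state_after M x u t = to_nat (fst (vrun x u t))"
  unfolding state_after_def using config_vrun by blast

text \<open>The first blank behind the certificate leads to \<open>Rej\<close> unless the run has
  halted already, so \<open>length u + 1\<close> steps always suffice.\<close>

lemma polynomial_time_M: "polynomial_time M"
proof -
  have "fst (vrun x u t) \<in> {Acc, Rej}" if "length u < t" for x u t
  proof (cases t)
    case (Suc s)
    then have "letter u (int s) = None" using that by (simp add: letter_None_iff)
    then show ?thesis using vstep_None by (simp add: Suc vrun_Suc)
  qed (use that in simp)
  then have "state_after M x u (poly [:1, 1:] (length x + length u)) \<in> halt_states M" for x u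
    by (simp add: state_after_M halt_states_M del: insert_iff)
  then show ?thesis unfolding polynomial_time_def by blast
qed

lemma accepts_M_sound:
  assumes "accepts M x u"
  obtains w d e where "set w \<subseteq> {..<K}" "locally_valid Q w d e" "List.map_filter emit w = x"
proof -
  obtain t where "to_nat (fst (vrun x u t)) = to_nat Acc"
    using assms by (auto simp: accepts_def state_after_M accept_state_M)
  then have "fst (vrun x u t) = Acc" by simp
  then show ?thesis
    using Inv_vrun[of x u t] that by (cases "vrun x u t") (auto simp: Inv_def Let_def)
qed

text \<open>In the phases \<open>Seek\<close> and \<open>Check\<close> the bits only act as a clock.
  The extra bit after \<open>length x\<close> is for the step that notices the end of the input, the
  one after \<open>length w\<close> for the test at position -1.\<close>

definition bits :: "'a list \<Rightarrow> nat list \<Rightarrow> nat \<Rightarrow> nat \<Rightarrow> bool list" where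
  "bits x w d e = concat (map (\<lambda>c. replicate c True @ [False]) w) @ replicate K True @ [False] @
     replicate d True @ [False] @ replicate e True @ [False] @
     replicate (length x) True @ [True] @ replicate (Suc (length w)) True"

lemma length_bits:
  assumes "set w \<subseteq> {..<K}"
  shows "length (bits x w d e) \<le> length w * (K + 2) + K + d + e + length x + 5"
proof -
  have "length (concat (map (\<lambda>c. replicate c True @ [False]) w)) \<le> length w * (K + 1)"
    using assms by (induction w) auto
  then show ?thesis by (simp add: bits_def)
qed

abbreviation run :: "'a list \<Rightarrow> bool list \<Rightarrow> verifier_config \<Rightarrow> verifier_config" where
  "run x u \<equiv> fold (vstep x) (map Some u)"

lemma run_Push_True:
  assumes "k + c \<le> K"
  shows "run x (replicate k True) (Push c, r) = (Push (k + c), r)"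
  using assms
proof (induction k arbitrary: c)
  case (Suc k)
  then show ?case using Suc.IH[of "Suc c"] by (cases r) simp
qed simp

lemma run_Push_word:
  assumes "set w \<subseteq> {..<K}"
  shows "run x (concat (map (\<lambda>c. replicate c True @ [False]) w)) (Push 0, v, i, h1, h2, h3) =
    (Push 0, v @ w, i, h1 + int (length w), h2 + int (length w), h3 + int (length w))"
  using assms
proof (induction w arbitrary: v h1 h2 h3)
  case (Cons c w)
  then show ?case by (simp add: run_Push_True Cons.IH del: map_replicate)
qed simp

lemma run_Shift1:
  "run x (replicate d True) (Shift1, w, i, h1, h2, h3) = (Shift1, w, i, h1, h2 - int d, h3)"
  by (induction d arbitrary: h2) auto

lemma run_Shift2:
  "run x (replicate d True) (Shift2, w, i, h1, h2, h3) = (Shift2, w, i, h1, h2, h3 - int d)"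
  by (induction d arbitrary: h3) auto

lemma run_Seek:
  assumes "k + m = length x"
  shows "run x (replicate k True) (Seek, w, int m, h1, h2, h3) = (Seek, w, int (length x), h1, h2, h3)"
  using assms
proof (induction k arbitrary: m)
  case (Suc k)
  then show ?case using Suc.IH[of "Suc m"] by (simp add: letter_None_iff add.commute)
qed simp

text \<open>Induction on the number \<open>p\<close> of letters still ahead of the head; they have
  to emit exactly the \<open>m\<close> input symbols that are still unmatched.\<close>

lemma run_Check:
  assumes "locally_valid Q w d e" and "p \<le> length w"
    and "List.map_filter emit (take p w) = take m x" "m \<le> length x"
  shows "fst (run x (replicate (Suc p) True) (Check (letter w (int p)), w, int m - 1, int p - 1,
      int p - 1 - int d, int p - 1 - int e)) = Acc"
  using assms(2-)
proof (induction p arbitrary: m)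
  case 0
  have "Q (letter w 0) (letter w (-1)) (letter w (-1 - int d)) (letter w (-1 - int e))"
    using assms(1) by (auto simp: locally_valid_def dest: bspec[of _ _ "-1"])
  moreover have "letter w (-1) = None" by (simp add: letter_None_iff)
  moreover have "m = 0" using 0 by (cases x) (auto simp: List.map_filter_def)
  moreover have "letter x (-1) = None" by (simp add: letter_None_iff)
  ultimately show ?case by simp
next
  case (Suc p)
  have "Q (letter w (int p + 1)) (letter w (int p)) (letter w (int p - int d)) (letter w (int p - int e))"
    using assms(1) Suc.prems(1) by (simp add: locally_valid_def del: letter_int)
  then have q: "Q (letter w (1 + int p)) (Some (w ! p)) (letter w (int p - int d)) (letter w (int p - int e))"
    using Suc.prems(1) by (simp add: add.commute)
  have p: "letter w (int p) = Some (w ! p)" using Suc.prems(1) by simp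
  have tk: "take (Suc p) w = take p w @ [w ! p]"
    using Suc.prems(1) by (simp add: take_Suc_conv_app_nth)
  show ?case
  proof (cases "emit (w ! p)")
    case None
    then have "List.map_filter emit (take p w) = take m x"
      using Suc.prems(2) by (simp add: tk List.map_filter_def)
    from Suc.IH[OF _ this] show ?thesis
      using Suc.prems q None p by (simp add: algebra_simps)
  next
    case (Some a)
    then have *: "List.map_filter emit (take p w) @ [a] = take m x"
      using Suc.prems(2) by (simp add: tk List.map_filter_def)
    then obtain l where l: "m = Suc l" by (cases m) auto
    then have "take m x = take l x @ [x ! l]" using Suc.prems(3) by (simp add: take_Suc_conv_app_nth)
    with * have **: "List.map_filter emit (take p w) = take l x" "x ! l = a" by auto
    from Suc.IH[OF _ this(1)] show ?thesis
      using Suc.prems q Some p l **(2) by (simp add: algebra_simps)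
  qed
qed

lemma accepts_M_complete:
  assumes w: "set w \<subseteq> {..<K}" and v: "locally_valid Q w d e" and x: "List.map_filter emit w = x"
  shows "accepts M x (bits x w d e)"
proof -
  have 1: "letter x (int (length x)) = None" "letter w (int (length w)) = None"
    by (simp_all add: letter_None_iff)
  have "run x (bits x w d e) (Push 0, [], 0, 0, 0, 0) =
     run x (replicate (Suc (length w)) True) (Check (letter w (int (length w))), w, int (length x) - 1,
       int (length w) - 1, int (length w) - 1 - int d, int (length w) - 1 - int e)"
    using run_Seek[of "length x" 0 x] 1
    by (simp add: bits_def run_Push_word[OF w] run_Push_True run_Shift1 run_Shift2
        del: replicate.simps map_replicate)
  also have "fst \<dots> = Acc"
    using x by (intro run_Check[OF v]) auto
  finally have "state_after M x (bits x w d e) (length (bits x w d e)) = accept_state M"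
    by (simp add: state_after_M vrun_length accept_state_M)
  then show ?thesis unfolding accepts_def by blast
qed

end

text \<open>Numbering \<open>S\<close> by \<open>{..<K}\<close> turns letters into work symbols.
  Letters and distances are spelled in unary, so bounds on the word and on \<open>d\<close> and
  \<open>e\<close> bound the certificate; soundness ranges over all distances since the certificate
  chooses them.\<close>

theorem NP_local_constraints:
  fixes L :: "'a::finite list set" and emit :: "'s \<Rightarrow> 'a option" and q :: "nat poly"
  assumes "finite S"
    and sound: "\<And>w d e. set w \<subseteq> S \<Longrightarrow> locally_valid Q w d e \<Longrightarrow> List.map_filter emit w \<in> L"
    and complete: "\<And>x. x \<in> L \<Longrightarrow> \<exists>w d e. set w \<subseteq> S \<and> locally_valid Q w d e \<and>
      List.map_filter emit w = x \<and> length w \<le> poly q (length x) \<and> d \<le> length w \<and> e \<le> length w"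
  shows "L \<in> NP"
proof -
  obtain K :: nat and f where S: "S = f ` {..<K}"
    using finite_imp_nat_seg_image_inj_on[OF \<open>finite S\<close>] by (auto simp: lessThan_def)
  define Q' where "Q' = (\<lambda>a b c d. Q (map_option f a) (map_option f b) (map_option f c) (map_option f d))"
  interpret local_verifier K "emit \<circ> f" Q' .
  have valid: "locally_valid Q' w d e \<longleftrightarrow> locally_valid Q (map f w) d e" for w d e
    by (simp add: locally_valid_def Q'_def letter_map)
  have filt: "List.map_filter (emit \<circ> f) w = List.map_filter emit (map f w)" for w
    by (simp add: List.map_filter_def filter_map comp_def)
  \<comment> \<open>Each letter costs at most \<open>K + 1\<close> bits to push and one bit to
    check; \<open>d\<close> and \<open>e\<close> add at most two more bits per letter.\<close>
  define P where "P = Polynomial.smult (K + 4) q + [:K + 5, 1:]"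
  have "x \<in> L \<longleftrightarrow> (\<exists>u. length u \<le> poly P (length x) \<and> accepts M x u)" for x
  proof
    assume "x \<in> L"
    then obtain v d e where v: "set v \<subseteq> S" "locally_valid Q v d e"
      "List.map_filter emit v = x" "length v \<le> poly q (length x)" "d \<le> length v" "e \<le> length v"
      using complete by blast
    then have "v \<in> lists (f ` {..<K})" using S by auto
    then obtain w where w: "v = map f w" "set w \<subseteq> {..<K}"
      unfolding lists_image by auto
    have "length (bits x w d e) \<le> length w * (K + 2) + K + d + e + length x + 5"
      by (rule length_bits[OF w(2)])
    also have "\<dots> \<le> length w * (K + 4) + K + length x + 5"
      using v w by (simp add: algebra_simps)
    also have "\<dots> \<le> poly q (length x) * (K + 4) + K + length x + 5"
      using v(4) w by (intro add_mono mult_mono) auto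
    also have "\<dots> = poly P (length x)" by (simp add: P_def algebra_simps)
    finally show "\<exists>u. length u \<le> poly P (length x) \<and> accepts M x u"
      using accepts_M_complete[OF w(2), of d e x] v w by (auto simp: valid filt)
  next
    assume "\<exists>u. length u \<le> poly P (length x) \<and> accepts M x u"
    then obtain w d e where w: "set w \<subseteq> {..<K}" "locally_valid Q' w d e" "List.map_filter (emit \<circ> f) w = x"
      using accepts_M_sound by metis
    then have "set (map f w) \<subseteq> S" using S by auto
    then show "x \<in> L" using sound w by (metis valid filt)
  qed
  then show ?thesis
    unfolding NP_def using turing_machine_M polynomial_time_M by blast
qed

section \<open>Periodic marks in a word\<close>

lemma letter_diff:
  "p < length w \<Longrightarrow> letter w (int p - int d) = (if p < d then None else Some (w ! (p - d)))"
  by (auto simp: letter_def nat_diff_distrib simp flip: of_nat_diff)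

lemma locally_valid_iff:
  "locally_valid Q w d e \<longleftrightarrow>
     Q (letter w 0) None None None \<and>
     (\<forall>p<length w. Q (if Suc p < length w then Some (w ! Suc p) else None) (Some (w ! p))
        (if p < d then None else Some (w ! (p - d))) (if p < e then None else Some (w ! (p - e))))"
proof -
  have "{-1..<int (length w)} = insert (-1) (int ` {..<length w})"
  proof (intro equalityI subsetI)
    fix p assume "p \<in> {-1..<int (length w)}"
    then have "p = -1 \<or> p = int (nat p) \<and> nat p < length w" by auto
    then show "p \<in> insert (-1) (int ` {..<length w})" by blast
  qed auto
  moreover have "letter w (-1) = None" "letter w (-1 - int d) = None" "letter w (-1 - int e) = None"
    by (simp_all add: letter_def)
  moreover have "letter w (int p + 1) = (if Suc p < length w then Some (w ! Suc p) else None)" for p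
    by (auto simp: letter_def nat_add_distrib)
  ultimately show ?thesis
    unfolding locally_valid_def by (auto simp: letter_diff)
qed

text \<open>The flag \<open>f\<close> survives up to and including the first mark, and it holds
  exactly below \<open>d\<close>; hence the first mark is at \<open>d - 1\<close>, or at
  \<open>N - 1\<close> if \<open>d\<close> reaches beyond the word, which is why the minimum
  appears. Periodicity then places all other marks, and the mark at the end gives
  divisibility.\<close>

lemma periodic_marks:
  fixes P f :: "nat \<Rightarrow> bool"
  assumes "0 < N" and f: "\<And>p. p < N \<Longrightarrow> f p \<longleftrightarrow> p < d" and "f 0"
    and step: "\<And>p. Suc p < N \<Longrightarrow> f (Suc p) \<longleftrightarrow> f p \<and> \<not> P p" and last: "P (N - 1)"
    and per: "\<And>p. d \<le> p \<Longrightarrow> p < N \<Longrightarrow> P p \<longleftrightarrow> P (p - d)"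
  shows "0 < min d N" "min d N dvd N" "\<And>p. p < N \<Longrightarrow> P p \<longleftrightarrow> min d N dvd Suc p"
proof -
  have "0 < d" using f[of 0] assms by simp
  then show D: "0 < min d N" using \<open>0 < N\<close> by simp
  show P: "P p \<longleftrightarrow> min d N dvd Suc p" if "p < N" for p
    using that
  proof (induction p rule: less_induct)
    case (less p)
    show ?case
    proof (cases "p < min d N")
      case True
      then have "min d N dvd Suc p \<longleftrightarrow> Suc p = min d N"
        by (metis Suc_leI dvd_imp_le dvd_refl le_antisym zero_less_Suc)
      moreover have "P p \<longleftrightarrow> Suc p = min d N"
      proof (cases "Suc p < N")
        case True
        then show ?thesis using step[OF True] f[of p] f[OF True] \<open>p < min d N\<close> by auto
      next
        case False
        then have "p = N - 1" using less.prems by simp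
        then show ?thesis using last \<open>p < min d N\<close> by auto
      qed
      ultimately show ?thesis by simp
    next
      case False
      then have d: "d \<le> p" "min d N = d" using less.prems by auto
      then have "P p \<longleftrightarrow> d dvd Suc (p - d)"
        using per[of p] less.IH[of "p - d"] less.prems \<open>0 < d\<close> by auto
      also have "\<dots> \<longleftrightarrow> d dvd Suc p"
        using d by (metis Suc_diff_le dvd_minus_self le_Suc_eq not_less)
      finally show ?thesis using d by simp
    qed
  qed
  show "min d N dvd N" using P[of "N - 1"] last \<open>0 < N\<close> by simp
qed

section \<open>Tiles\<close>

fun horner :: "(nat \<Rightarrow> int) \<Rightarrow> nat \<Rightarrow> int" where
  "horner f 0 = 0"
| "horner f (Suc n) = 10 * horner f n + f n"

lemma horner_add_diff:
  "horner (\<lambda>d. f d + g d - h d) n = horner f n + horner g n - horner h n"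
  by (induction n) auto

lemma horner_cong: "(\<And>d. d < n \<Longrightarrow> f d = g d) \<Longrightarrow> horner f n = horner g n"
  by (induction n) auto

text \<open>Position 0 is the most significant one. Every digit carries the sign of
  \<open>v\<close>, so numbers of different signs can be added digit by digit without
  carries.\<close>

definition signed_digit :: "int \<Rightarrow> nat \<Rightarrow> nat \<Rightarrow> int" where
  "signed_digit v L d = sgn v * int (nat \<bar>v\<bar> div 10 ^ (L - 1 - d) mod 10)"

lemma horner_signed_digit_prefix:
  assumes "nat \<bar>v\<bar> < 10 ^ L" "d \<le> L"
  shows "horner (signed_digit v L) d = sgn v * int (nat \<bar>v\<bar> div 10 ^ (L - d))"
  using assms(2)
proof (induction d)
  case 0
  then show ?case using assms(1) by simp
next
  case (Suc d)
  then have "L - d = Suc (L - Suc d)" by simp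
  then have q: "nat \<bar>v\<bar> div 10 ^ (L - d) = nat \<bar>v\<bar> div 10 ^ (L - Suc d) div 10"
    by (simp only: power_Suc2 div_mult2_eq)
  define q where "q = nat \<bar>v\<bar> div 10 ^ (L - Suc d)"
  have "horner (signed_digit v L) (Suc d) = sgn v * (10 * int (q div 10) + int (q mod 10))"
    using Suc q by (simp add: signed_digit_def[of v L d] q_def [symmetric] distrib_left)
  also have "10 * int (q div 10) + int (q mod 10) = int q" by presburger
  finally show ?case by (simp add: q_def)
qed

lemma horner_signed_digit: "nat \<bar>v\<bar> < 10 ^ L \<Longrightarrow> horner (signed_digit v L) L = v"
  by (simp add: horner_signed_digit_prefix sgn_mult_abs)

lemma signed_digit_bound: "signed_digit v L d \<in> {-9..9}"
proof -
  define q where "q = nat \<bar>v\<bar> div 10 ^ (L - 1 - d) mod 10"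
  have "q < 10" by (simp add: q_def)
  then show ?thesis unfolding signed_digit_def q_def [symmetric] by (auto simp: sgn_if)
qed

text \<open>The threshold 3 reproduces itself, since \<open>10 * 3 - 27 = 3\<close>; here 27 bounds
  a combination of three signed digits.\<close>

definition clamp :: "int \<Rightarrow> int" where
  "clamp v = (if v \<le> -3 then -3 else if 3 \<le> v then 3 else v)"

text \<open>Once the value of a prefix has left \<open>{-2..2}\<close>, no further digits can bring it back.\<close>

lemma clamp_horner_step: "\<bar>e\<bar> \<le> 27 \<Longrightarrow> clamp (10 * clamp v + e) = clamp (10 * v + e)"
  by (auto simp: clamp_def)

lemma clamp_bound: "clamp v \<in> {-3..3}"
  by (auto simp: clamp_def)

lemma clamp_nonneg_iff: "0 \<le> clamp v \<longleftrightarrow> 0 \<le> v" and clamp_eq_0_iff: "clamp v = 0 \<longleftrightarrow> v = 0"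
  by (auto simp: clamp_def)

text \<open>
  The kinds of the tiles of a cell are \<open>Sgn\<close>, some \<open>Pad\<close>, then \<open>Zero\<close> or the decimal digits of the
  absolute value, and \<open>Sep\<close>. The lists \<open>bs\<close>, \<open>cs\<close>, \<open>vs\<close> are indexed by \<open>\<tau> < k\<close>; \<open>bs\<close> and \<open>cs\<close> hold
  signed digits, \<open>vs\<close> the clamped Horner value including the present tile. As \<open>Sep\<close> counts as a
  digit \<open>0\<close> of \<open>A\<close>, all digits in a cell spell ten times the intended numbers. The flags
  \<open>first_cell\<close> and \<open>first_row\<close>, which have to hold exactly where the distances \<open>d\<close> and \<open>e\<close> lead out of
  the word, force these distances to be the widths of a cell and of a row.
\<close>

datatype kind = Sgn | Pad | Zero | Dig nat | Sep

datatype tile = Tile (kind: kind) (neg: bool) (last_col: bool) (first_cell: bool) (first_row: bool)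
  (bs: "int list") (cs: "int list") (vs: "int list")

text \<open>\<open>Pad\<close> is silent, so that entries of different lengths can fill cells of
  equal width.\<close>

fun emit :: "tile \<Rightarrow> char option" where
  "emit (Tile Sgn s l c r b c' v) = Some (if s then CHR ''-'' else CHR ''+'')"
| "emit (Tile Pad s l c r b c' v) = None"
| "emit (Tile Zero s l c r b c' v) = Some (CHR ''0'')"
| "emit (Tile (Dig n) s l c r b c' v) = Some (''0123456789'' ! n)"
| "emit (Tile Sep s l c r b c' v) = Some (if l then CHR '';'' else CHR '','')"

fun a_digit :: "tile \<Rightarrow> int" where
  "a_digit (Tile (Dig n) s l c r b c' v) = (if s then - int n else int n)"
| "a_digit _ = 0"

text \<open>The first digit after the sign or padding is nonzero, which makes the emitted digits
  agree with \<open>decimal\<close>; the number zero has the kind \<open>Zero\<close> of its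
  own.\<close>

fun kind_link :: "kind \<Rightarrow> kind \<Rightarrow> bool" where
  "kind_link k Sgn \<longleftrightarrow> k = Sep"
| "kind_link k Sep \<longleftrightarrow> k = Zero \<or> (\<exists>n. k = Dig n)"
| "kind_link k (Dig n) \<longleftrightarrow> n < 10 \<and> (k \<in> {Sgn, Pad} \<and> 0 < n \<or> (\<exists>n. k = Dig n))"
| "kind_link k _ \<longleftrightarrow> k \<in> {Sgn, Pad}"

definition starts_cell :: "tile option \<Rightarrow> bool" where
  "starts_cell o' \<longleftrightarrow> (case o' of None \<Rightarrow> True | Some t \<Rightarrow> kind t = Sep)"

text \<open>\<open>o'\<close> is the tile preceding \<open>t\<close>. The two flag clauses supply
  the step hypothesis of \<open>periodic_marks\<close>, with separators and with row ends as
  marks.\<close>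

definition link :: "nat \<Rightarrow> tile option \<Rightarrow> tile \<Rightarrow> bool" where
  "link k o' t \<longleftrightarrow>
     kind_link (if starts_cell o' then Sep else kind (the o')) (kind t) \<and>
     (\<not> starts_cell o' \<longrightarrow> neg t = neg (the o') \<and> last_col t = last_col (the o')) \<and>
     (\<forall>\<tau><k. vs t ! \<tau> =
        clamp (10 * (if starts_cell o' then 0 else vs (the o') ! \<tau>) + (bs t ! \<tau> + cs t ! \<tau> - a_digit t))) \<and>
     (first_cell t \<longleftrightarrow> o' = None \<or> first_cell (the o') \<and> kind (the o') \<noteq> Sep) \<and>
     (first_row t \<longleftrightarrow> o' = None \<or> first_row (the o') \<and> \<not> (kind (the o') = Sep \<and> last_col (the o')))"

text \<open>\<open>lft\<close> and \<open>up\<close> are the tiles at the distances \<open>d\<close>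
  and \<open>e\<close> before \<open>t\<close>. A left neighbour in the last column belongs to the
  previous row, hence the exemption for \<open>bs\<close>. The clause on \<open>Zero\<close>
  excludes the spelling -0, and the one on \<open>Sep\<close> says that the minimum over \<tau> is
  the entry.\<close>

definition tile_ok :: "nat \<Rightarrow> tile \<Rightarrow> tile option \<Rightarrow> tile option \<Rightarrow> bool" where
  "tile_ok k t lft up \<longleftrightarrow>
     (first_cell t \<longleftrightarrow> lft = None) \<and> (first_row t \<longleftrightarrow> up = None) \<and>
     (\<forall>l. lft = Some l \<longrightarrow> (kind t = Sep \<longleftrightarrow> kind l = Sep) \<and> (last_col l \<or> bs t = bs l)) \<and>
     (\<forall>u. up = Some u \<longrightarrow>
        (kind t = Sep \<and> last_col t \<longleftrightarrow> kind u = Sep \<and> last_col u) \<and> cs t = cs u) \<and>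
     (kind t = Zero \<longrightarrow> \<not> neg t) \<and>
     (kind t = Sep \<longrightarrow> (\<forall>\<tau><k. 0 \<le> vs t ! \<tau>) \<and> (\<exists>\<tau><k. vs t ! \<tau> = 0))"

text \<open>The case without successor makes the word end with a row; at position -1 it excludes the
  empty word.\<close>

definition constraint ::
    "nat \<Rightarrow> tile option \<Rightarrow> tile option \<Rightarrow> tile option \<Rightarrow> tile option \<Rightarrow> bool" where
  "constraint k nxt cur lft up \<longleftrightarrow>
     (case nxt of
        None \<Rightarrow> cur \<noteq> None \<and> kind (the cur) = Sep \<and> last_col (the cur)
      | Some t \<Rightarrow> link k cur t) \<and>
     (case cur of None \<Rightarrow> True | Some t \<Rightarrow> tile_ok k t lft up)"

definition tiles :: "nat \<Rightarrow> tile set" where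
  "tiles k = (\<lambda>(kd, s, l, c, r, b, c', v). Tile kd s l c r b c' v) `
     (({Sgn, Pad, Zero, Sep} \<union> Dig ` {..<10}) \<times> UNIV \<times> UNIV \<times> UNIV \<times> UNIV \<times>
      {xs. set xs \<subseteq> {-9..9} \<and> length xs = k} \<times> {xs. set xs \<subseteq> {-9..9} \<and> length xs = k} \<times>
      {xs. set xs \<subseteq> {-3..3} \<and> length xs = k})"

lemma finite_tiles: "finite (tiles k)"
  unfolding tiles_def by (intro finite_imageI finite_cartesian_product finite_lists_length_eq) auto

lemma mem_tiles:
  "t \<in> tiles k \<longleftrightarrow> kind t \<in> {Sgn, Pad, Zero, Sep} \<union> Dig ` {..<10} \<and>
     set (bs t) \<subseteq> {-9..9} \<and> length (bs t) = k \<and> set (cs t) \<subseteq> {-9..9} \<and> length (cs t) = k \<and>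
     set (vs t) \<subseteq> {-3..3} \<and> length (vs t) = k"
  by (cases t) (auto simp: tiles_def image_iff)

lemma a_digit_bound: "t \<in> tiles k \<Longrightarrow> \<bar>a_digit t\<bar> \<le> 9"
  by (cases t rule: a_digit.cases) (auto simp: mem_tiles)

lemma tile_digit_bound:
  assumes "t \<in> tiles k" "\<tau> < k"
  shows "\<bar>bs t ! \<tau> + cs t ! \<tau> - a_digit t\<bar> \<le> 27"
proof -
  have "bs t ! \<tau> \<in> set (bs t)" "cs t ! \<tau> \<in> set (cs t)" using assms by (auto simp: mem_tiles)
  moreover have "set (bs t) \<subseteq> {-9..9}" "set (cs t) \<subseteq> {-9..9}" using assms by (simp_all add: mem_tiles)
  ultimately have "bs t ! \<tau> \<in> {-9..9}" "cs t ! \<tau> \<in> {-9..9}" by blast+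
  then show ?thesis
    using a_digit_bound[OF assms(1)] unfolding atLeastAtMost_iff abs_le_iff by linarith
qed

section \<open>Decoding a cell\<close>

lemma decimal_snoc:
  assumes "0 < u" "n < 10"
  shows "decimal (10 * u + n) = decimal u @ [''0123456789'' ! n]"
proof -
  have "(10 * u + n) div 10 = u" "(10 * u + n) mod 10 = n" "\<not> 10 * u + n < 10"
    using assms by simp_all
  then show ?thesis using decimal.simps[of "10 * u + n"] by (simp only: if_False)
qed

lemma decimal_digit: "n < 10 \<Longrightarrow> decimal n = [''0123456789'' ! n]"
  using decimal.simps[of n] by (simp only: if_True)

text \<open>Along the cell, \<open>kind_link\<close> makes the emitted decimal grow in step with
  Horner's value, and \<open>Sep\<close> contributes a last factor ten. The values \<open>vs\<close>
  follow because clamping after every step gives the same result as clamping once at the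
  end.\<close>

lemma cell_decodes:
  assumes "0 < L" and tl: "\<And>d. d < L \<Longrightarrow> g d \<in> tiles k"
    and first: "starts_cell o'" "link k o' (g 0)"
    and lnk: "\<And>d. Suc d < L \<Longrightarrow> link k (Some (g d)) (g (Suc d))"
    and sep: "\<And>d. d < L \<Longrightarrow> kind (g d) = Sep \<longleftrightarrow> Suc d = L"
    and zero: "\<And>d. d < L \<Longrightarrow> kind (g d) = Zero \<Longrightarrow> \<not> neg (g d)"
  shows "\<exists>a. horner (\<lambda>d. a_digit (g d)) L = 10 * a \<and> List.map_filter emit (map g [0..<L]) =
      encode_int a @ (if last_col (g (L - 1)) then '';'' else '','')"
    and "\<tau> < k \<Longrightarrow> vs (g (L - 1)) ! \<tau> =
      clamp (horner (\<lambda>d. bs (g d) ! \<tau> + cs (g d) ! \<tau> - a_digit (g d)) L)"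
proof -
  let ?sg = "if neg (g 0) then ''-'' else ''+''"
  let ?E = "\<lambda>d. List.map_filter emit (map g [0..<Suc d])"
  let ?H = "\<lambda>d. horner (\<lambda>d. a_digit (g d)) (Suc d)"
  have inv: "neg (g d) = neg (g 0) \<and>
    (case kind (g d) of
       Zero \<Rightarrow> ?E d = ?sg @ ''0'' \<and> ?H d = 0
     | Dig n \<Rightarrow> \<exists>u>0. ?E d = ?sg @ decimal u \<and> ?H d = (if neg (g 0) then - int u else int u)
     | Sep \<Rightarrow> \<exists>a. ?E d = encode_int a @ (if last_col (g d) then '';'' else '','') \<and> ?H d = 10 * a
     | _ \<Rightarrow> ?E d = ?sg \<and> ?H d = 0)" if "d < L" for d
    using that
  proof (induction d)
    case 0
    have "kind (g 0) = Sgn"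
      using first by (cases "kind (g 0)") (auto simp: link_def)
    then show ?case by (cases "g 0") (simp add: List.map_filter_def)
  next
    case (Suc d)
    note IH = Suc.IH[OF Suc_lessD[OF Suc.prems]]
    have ns: "kind (g d) \<noteq> Sep" using sep[of d] Suc.prems by simp
    have l: "kind_link (kind (g d)) (kind (g (Suc d)))" "neg (g (Suc d)) = neg (g d)"
      using lnk[OF Suc.prems] ns by (auto simp: link_def starts_cell_def)
    have E: "?E (Suc d) = ?E d @ (case emit (g (Suc d)) of None \<Rightarrow> [] | Some c \<Rightarrow> [c])"
      by (simp add: List.map_filter_def split: option.split)
    have H: "?H (Suc d) = 10 * ?H d + a_digit (g (Suc d))" by simp
    show ?case
    proof (cases "kind (g (Suc d))")
      case Sgn
      then show ?thesis using l ns by simp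
    next
      case Pad
      then show ?thesis unfolding E H using l IH by (cases "g (Suc d)") auto
    next
      case Zero
      then show ?thesis unfolding E H using l IH by (cases "g (Suc d)") auto
    next
      case (Dig n)
      from l Dig consider "kind (g d) \<in> {Sgn, Pad}" "0 < n" "n < 10" | m where "kind (g d) = Dig m" "n < 10"
        by auto
      then show ?thesis
      proof cases
        case 1
        then have "?E d = ?sg" "?H d = 0" using IH by auto
        then show ?thesis
          unfolding E H using Dig 1 l IH by (cases "g (Suc d)") (auto intro!: exI[of _ n] simp: decimal_digit)
      next
        case 2
        then obtain u where "u > 0" "?E d = ?sg @ decimal u" "?H d = (if neg (g 0) then - int u else int u)"
          using IH by auto
        then show ?thesis
          unfolding E H using Dig 2 l IH
          by (cases "g (Suc d)") (auto intro!: exI[of _ "10 * u + n"] simp: decimal_snoc)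
      qed
    next
      case Sep
      from l Sep consider "kind (g d) = Zero" | m where "kind (g d) = Dig m" by auto
      then show ?thesis
      proof cases
        case 1
        \<comment> \<open>\<open>encode_int 0\<close> has a plus sign, so the sign emitted before
          \<open>Zero\<close> must not be a minus.\<close>
        then have "?E d = ?sg @ ''0''" "?H d = 0" "\<not> neg (g d)"
          using IH zero[of d] Suc.prems by auto
        then show ?thesis
          unfolding E H using Sep l IH
          by (cases "g (Suc d)") (auto intro!: exI[of _ 0] simp: encode_int_def decimal_digit)
      next
        case 2
        then obtain u where "u > 0" "?E d = ?sg @ decimal u" "?H d = (if neg (g 0) then - int u else int u)"
          using IH by auto
        then show ?thesis
          unfolding E H using Sep l IH
          by (cases "g (Suc d)") (auto intro!: exI[of _ "if neg (g 0) then - int u else int u"] simp: encode_int_def)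
      qed
    qed
  qed
  obtain l where l: "L = Suc l" using \<open>0 < L\<close> by (cases L) auto
  have "kind (g l) = Sep" using sep[of l] l by simp
  then show "\<exists>a. horner (\<lambda>d. a_digit (g d)) L = 10 * a \<and> List.map_filter emit (map g [0..<L]) =
      encode_int a @ (if last_col (g (L - 1)) then '';'' else '','')"
    using inv[of l] unfolding l by auto
  show "vs (g (L - 1)) ! \<tau> =
      clamp (horner (\<lambda>d. bs (g d) ! \<tau> + cs (g d) ! \<tau> - a_digit (g d)) L)" if "\<tau> < k"
  proof -
    have "vs (g d) ! \<tau> = clamp (horner (\<lambda>d. bs (g d) ! \<tau> + cs (g d) ! \<tau> - a_digit (g d)) (Suc d))"
      if "d < L" for d
      using that
    proof (induction d)
      case 0
      then show ?case using first \<open>\<tau> < k\<close> by (simp add: link_def)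
    next
      case (Suc d)
      have "kind (g d) \<noteq> Sep" using sep[of d] Suc.prems by simp
      then have "vs (g (Suc d)) ! \<tau> =
          clamp (10 * vs (g d) ! \<tau> + (bs (g (Suc d)) ! \<tau> + cs (g (Suc d)) ! \<tau> - a_digit (g (Suc d))))"
        using lnk[OF Suc.prems] \<open>\<tau> < k\<close> by (simp add: link_def starts_cell_def)
      then show ?case
        using Suc clamp_horner_step[OF tile_digit_bound[OF tl[OF Suc.prems] \<open>\<tau> < k\<close>]] by simp
    qed
    from this[of l] show ?thesis unfolding l by simp
  qed
qed

section \<open>Cutting words into blocks, and minima as inequalities\<close>

lemma map_upt_mult:
  "map f [0..<n * L] = concat (map (\<lambda>j. map (\<lambda>d. f (j * L + d)) [0..<L]) [0..<n])"
proof (induction n)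
  case (Suc n)
  have "[0..<Suc n * L] = [0..<n * L] @ map (\<lambda>d. n * L + d) [0..<L]"
    by (rule nth_equalityI) (auto simp: nth_append)
  then show ?case using Suc by simp
qed simp

lemma map_filter_concat: "List.map_filter f (concat xss) = concat (map (List.map_filter f) xss)"
  by (induction xss) (auto simp: List.map_filter_def)

text \<open>This is the form the tiles check: inequalities for all \<tau>, equality for one.
  \<open>0 < k\<close> makes the minimum range over a nonempty set.\<close>

lemma has_trop_factorization_iff:
  assumes "0 < k"
  shows "has_trop_factorization k A \<longleftrightarrow>
    (\<exists>b c. \<forall>i<dim_row A. \<forall>j<dim_col A.
       (\<forall>\<tau><k. real_of_int (A $$ (i, j)) \<le> b i \<tau> + c \<tau> j) \<and>
       (\<exists>\<tau><k. b i \<tau> + c \<tau> j = real_of_int (A $$ (i, j))))"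
    (is "_ \<longleftrightarrow> (\<exists>b c. ?P b c)")
proof -
  have Min: "Min (f ` {..<k}) = (y :: real) \<longleftrightarrow> (\<forall>\<tau><k. y \<le> f \<tau>) \<and> (\<exists>\<tau><k. f \<tau> = y)" for f y
  proof -
    have "f ` {..<k} \<noteq> {}" using assms by auto
    then have "Min (f ` {..<k}) = y \<longleftrightarrow> y \<in> f ` {..<k} \<and> (\<forall>z\<in>f ` {..<k}. y \<le> z)"
      by (intro Min_eq_iff) auto
    then show ?thesis by auto
  qed
  show ?thesis
  proof
    assume "has_trop_factorization k A"
    then obtain B C where BC: "B \<in> carrier_mat (dim_row A) k" "C \<in> carrier_mat k (dim_col A)"
      "B \<otimes>\<^sub>T C = map_mat real_of_int A"
      by (auto simp: has_trop_factorization_def)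
    have "?P (\<lambda>i \<tau>. B $$ (i, \<tau>)) (\<lambda>\<tau> j. C $$ (\<tau>, j))"
    proof (intro allI impI)
      fix i j assume ij: "i < dim_row A" "j < dim_col A"
      then have "(B \<otimes>\<^sub>T C) $$ (i, j) = real_of_int (A $$ (i, j))" using BC(3) by simp
      then have "Min ((\<lambda>\<tau>. B $$ (i, \<tau>) + C $$ (\<tau>, j)) ` {..<k}) = real_of_int (A $$ (i, j))"
        using carrier_matD[OF BC(1)] carrier_matD[OF BC(2)] ij by (simp add: trop_mult_def)
      then show "(\<forall>\<tau><k. real_of_int (A $$ (i, j)) \<le> B $$ (i, \<tau>) + C $$ (\<tau>, j)) \<and>
         (\<exists>\<tau><k. B $$ (i, \<tau>) + C $$ (\<tau>, j) = real_of_int (A $$ (i, j)))"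
        unfolding Min .
    qed
    then show "\<exists>b c. ?P b c" by (intro exI)
  next
    assume "\<exists>b c. ?P b c"
    then obtain b c where P: "?P b c" by (elim exE)
    let ?B = "mat (dim_row A) k (\<lambda>(i, \<tau>). b i \<tau>)" and ?C = "mat k (dim_col A) (\<lambda>(\<tau>, j). c \<tau> j)"
    have "?B \<otimes>\<^sub>T ?C = map_mat real_of_int A"
    proof (rule eq_matI)
      fix i j assume ij: "i < dim_row (map_mat real_of_int A)" "j < dim_col (map_mat real_of_int A)"
      have "Min ((\<lambda>\<tau>. b i \<tau> + c \<tau> j) ` {..<k}) = real_of_int (A $$ (i, j))"
        unfolding Min using P ij by simp
      moreover have "(\<lambda>\<tau>. ?B $$ (i, \<tau>) + ?C $$ (\<tau>, j)) ` {..<k} = (\<lambda>\<tau>. b i \<tau> + c \<tau> j) ` {..<k}"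
        using ij by (intro image_cong) auto
      ultimately show "(?B \<otimes>\<^sub>T ?C) $$ (i, j) = map_mat real_of_int A $$ (i, j)"
        using ij by (simp add: trop_mult_def)
    qed (simp_all add: trop_mult_def)
    then show "has_trop_factorization k A"
      unfolding has_trop_factorization_def by (intro bexI[of _ ?B] bexI[of _ ?C]) auto
  qed
qed

lemma mult_add_less: "a < b \<Longrightarrow> c < d \<Longrightarrow> a * d + c < b * (d :: nat)"
proof -
  assume "a < b" "c < d"
  then have "a * d + c < Suc a * d" by simp
  also have "\<dots> \<le> b * d" using \<open>a < b\<close> by (intro mult_right_mono) auto
  finally show ?thesis .
qed

section \<open>Reading off a factorization\<close>

text \<open>\<open>periodic_marks\<close> for separators and for row ends cuts the word into an
  array of cells. The horizontal and vertical comparisons make the digits of \<open>B\<close> depend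
  on the row only and those of \<open>C\<close> on the column only, and the test at each
  \<open>Sep\<close> is the factorization condition multiplied by ten.\<close>

lemma locally_valid_imp_TMF:
  assumes "0 < k" and w: "set w \<subseteq> tiles k" and valid: "locally_valid (constraint k) w d e"
  shows "List.map_filter emit w \<in> TMF k"
proof -
  define N where "N = length w"
  define L where "L = min d N"
  define R where "R = min e N"
  have c0: "constraint k (letter w 0) None None None"
    using valid unfolding locally_valid_iff by blast
  have c: "constraint k (if Suc p < N then Some (w ! Suc p) else None) (Some (w ! p))
      (if p < d then None else Some (w ! (p - d))) (if p < e then None else Some (w ! (p - e)))"
    if "p < N" for p
    using valid that unfolding locally_valid_iff N_def by blast
  have N: "0 < N"
    using c0 by (cases "0 < N") (auto simp: N_def constraint_def letter_def)
  have link0: "link k None (w ! 0)"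
    using c0 N by (auto simp: N_def constraint_def letter_def)
  have lnk: "link k (Some (w ! p)) (w ! Suc p)" if "Suc p < N" for p
    using c[of p] that by (simp add: constraint_def)
  have ok: "tile_ok k (w ! p) (if p < d then None else Some (w ! (p - d)))
      (if p < e then None else Some (w ! (p - e)))" if "p < N" for p
    using c[OF that] by (simp add: constraint_def)
  have last: "kind (w ! (N - 1)) = Sep" "last_col (w ! (N - 1))"
    using c[of "N - 1"] N by (auto simp: constraint_def)
  have in_tiles: "w ! p \<in> tiles k" if "p < N" for p
    using that w by (auto simp: N_def)
  have "first_cell (w ! p) \<longleftrightarrow> p < d" "first_row (w ! p) \<longleftrightarrow> p < e" if "p < N" for p
    using ok[OF that] by (auto simp: tile_ok_def split: if_splits)
  note first_iff = this
  have Suc_first: "first_cell (w ! Suc p) \<longleftrightarrow> first_cell (w ! p) \<and> kind (w ! p) \<noteq> Sep"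
      "first_row (w ! Suc p) \<longleftrightarrow> first_row (w ! p) \<and> \<not> (kind (w ! p) = Sep \<and> last_col (w ! p))"
    if "Suc p < N" for p
    using lnk[OF that] by (auto simp: link_def)
  have first0: "first_cell (w ! 0)" "first_row (w ! 0)"
    using link0 by (auto simp: link_def)
  have per_L: "kind (w ! p) = Sep \<longleftrightarrow> kind (w ! (p - d)) = Sep" if "d \<le> p" "p < N" for p
    using ok[of p] that by (auto simp: tile_ok_def)
  have L: "0 < L" "L dvd N" "kind (w ! p) = Sep \<longleftrightarrow> L dvd Suc p" if "p < N" for p
    unfolding L_def
    by (rule periodic_marks[of N "\<lambda>p. first_cell (w ! p)" d "\<lambda>p. kind (w ! p) = Sep"]; fact)+
  note L = L(1,2)[OF N] L(3)
  have per_R: "(kind (w ! p) = Sep \<and> last_col (w ! p)) \<longleftrightarrow> (kind (w ! (p - e)) = Sep \<and> last_col (w ! (p - e)))"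
    if "e \<le> p" "p < N" for p
    using ok[of p] that by (auto simp: tile_ok_def)
  have last': "kind (w ! (N - 1)) = Sep \<and> last_col (w ! (N - 1))"
    using last by simp
  have R: "0 < R" "R dvd N"
    "kind (w ! p) = Sep \<and> last_col (w ! p) \<longleftrightarrow> R dvd Suc p" if "p < N" for p
    unfolding R_def
    by (rule periodic_marks[of N "\<lambda>p. first_row (w ! p)" e "\<lambda>p. kind (w ! p) = Sep \<and> last_col (w ! p)"]; fact)+
  note R = R(1,2)[OF N] R(3)
  \<comment> \<open>A second position at distance \<open>L\<close> inside the word forces
    \<open>L = d\<close>, so the comparison made by \<open>tile_ok\<close> applies; likewise for
    \<open>R\<close> and \<open>e\<close> below.\<close>
  have bs_eq: "last_col (w ! p) \<or> bs (w ! (p + L)) = bs (w ! p)" if "p + L < N" for p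
  proof -
    have "L = d" using that by (auto simp: L_def)
    then show ?thesis using ok[OF that] by (auto simp: tile_ok_def)
  qed
  have cs_eq: "cs (w ! (p + R)) = cs (w ! p)" if "p + R < N" for p
  proof -
    have "R = e" using that by (auto simp: R_def)
    then show ?thesis using ok[OF that] by (auto simp: tile_ok_def)
  qed
  have "R \<le> N" by (simp add: R_def)
  \<comment> \<open>The end of the first row is a separator, so a row consists of whole
    cells.\<close>
  then have "kind (w ! (R - 1)) = Sep"
    using R(1) R(3)[of "R - 1"] by simp
  then have "L dvd R" using L(3)[of "R - 1"] R(1) \<open>R \<le> N\<close> by simp
  then obtain n where n: "R = n * L" by (metis dvd_def mult.commute)
  obtain m where m: "N = m * R" using R(2) by (metis dvd_def mult.commute)
  have mn: "0 < m" "0 < n" using N m n by auto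
  define pos where "pos i j = i * R + j * L" for i j
  have pos_less: "pos i j + t < N" if "i < m" "j < n" "t < L" for i j t
    using mult_add_less[OF that(1) mult_add_less[OF that(2,3), folded n]] by (simp add: pos_def m add.assoc)
  have pos_dvd: "L dvd pos i j" for i j by (simp add: pos_def n)
  have sep: "kind (w ! (pos i j + t)) = Sep \<longleftrightarrow> Suc t = L" if "i < m" "j < n" "t < L" for i j t
  proof -
    have "kind (w ! (pos i j + t)) = Sep \<longleftrightarrow> L dvd pos i j + Suc t"
      using L(3)[OF pos_less[OF that]] by simp
    also have "\<dots> \<longleftrightarrow> L dvd Suc t" by (rule dvd_add_right_iff[OF pos_dvd])
    also have "\<dots> \<longleftrightarrow> Suc t = L"
      using \<open>t < L\<close> by (auto dest: dvd_imp_le)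
    finally show ?thesis .
  qed
  \<comment> \<open>The column flag is constant within a cell, and at the separator it tells whether
    the row ends there.\<close>
  have lc0: "last_col (w ! (pos i j + t)) = last_col (w ! pos i j)" if "i < m" "j < n" "t < L" for i j t
    using that(3)
  proof (induction t)
    case (Suc t)
    then have "kind (w ! (pos i j + t)) \<noteq> Sep" using sep[of i j t] that by simp
    then have "last_col (w ! Suc (pos i j + t)) = last_col (w ! (pos i j + t))"
      using lnk[of "pos i j + t"] pos_less[OF that(1,2) Suc.prems] by (simp add: link_def starts_cell_def)
    then show ?case using Suc by simp
  qed simp
  have lc: "last_col (w ! (pos i j + t)) \<longleftrightarrow> Suc j = n" if "i < m" "j < n" "t < L" for i j t
  proof -
    have t': "L - 1 < L" using L(1) by simp
    have "last_col (w ! (pos i j + t)) = last_col (w ! (pos i j + (L - 1)))"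
      using lc0[OF that] lc0[OF that(1,2) t'] by simp
    also have "\<dots> \<longleftrightarrow> R dvd Suc (pos i j + (L - 1))"
      using R(3)[OF pos_less[OF that(1,2) t']] sep[OF that(1,2) t'] L(1) by simp
    also have "Suc (pos i j + (L - 1)) = i * R + Suc j * L"
      using L(1) by (simp add: pos_def)
    also have "R dvd \<dots> \<longleftrightarrow> n dvd Suc j"
      using L(1) by (simp add: dvd_add_right_iff n del: mult_Suc)
    also have "\<dots> \<longleftrightarrow> Suc j = n" using \<open>j < n\<close> by (auto dest: dvd_imp_le)
    finally show ?thesis .
  qed
  \<comment> \<open>The division is exact by \<open>cell_decodes\<close>; \<open>b\<close> and
    \<open>c\<close> remain ten times the intended numbers.\<close>
  define a where "a i j = horner (\<lambda>t. a_digit (w ! (pos i j + t))) L div 10" for i j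
  define b where "b i j \<tau> = horner (\<lambda>t. bs (w ! (pos i j + t)) ! \<tau>) L" for i j \<tau>
  define c where "c i j \<tau> = horner (\<lambda>t. cs (w ! (pos i j + t)) ! \<tau>) L" for i j \<tau>
  have cell_facts: "List.map_filter emit (map (\<lambda>t. w ! (pos i j + t)) [0..<L]) =
        encode_int (a i j) @ (if Suc j = n then '';'' else '','')
      \<and> (\<forall>\<tau><k. 10 * a i j \<le> b i j \<tau> + c i j \<tau>) \<and> (\<exists>\<tau><k. b i j \<tau> + c i j \<tau> = 10 * a i j)"
    if ij: "i < m" "j < n" for i j
  proof -
    define o' where "o' = (if pos i j = 0 then None else Some (w ! (pos i j - 1)))"
    have p0: "pos i j < N" using pos_less[OF ij L(1)] by simp
    have st: "starts_cell o'" "link k o' (w ! (pos i j + 0))"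
      using L(3)[of "pos i j - 1"] pos_dvd[of i j] p0 link0 lnk[of "pos i j - 1"]
      by (auto simp: o'_def starts_cell_def)
    have tl: "w ! (pos i j + t) \<in> tiles k" if "t < L" for t
      using in_tiles pos_less[OF ij that] by simp
    have ln: "link k (Some (w ! (pos i j + t))) (w ! (pos i j + Suc t))" if "Suc t < L" for t
      using lnk[of "pos i j + t"] pos_less[OF ij that] by simp
    have z: "\<not> neg (w ! (pos i j + t))" if "t < L" "kind (w ! (pos i j + t)) = Zero" for t
      using ok[OF pos_less[OF ij that(1)]] that(2) by (simp add: tile_ok_def)
    note sp = sep[OF ij]
    have cl: "\<exists>a. horner (\<lambda>t. a_digit (w ! (pos i j + t))) L = 10 * a \<and>
        List.map_filter emit (map (\<lambda>t. w ! (pos i j + t)) [0..<L]) =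
        encode_int a @ (if last_col (w ! (pos i j + (L - 1))) then '';'' else '','')"
      by (rule cell_decodes(1)[of L "\<lambda>t. w ! (pos i j + t)" k o']; fact)
    have cl_vs: "vs (w ! (pos i j + (L - 1))) ! \<tau> =
        clamp (horner (\<lambda>t. bs (w ! (pos i j + t)) ! \<tau> + cs (w ! (pos i j + t)) ! \<tau> -
          a_digit (w ! (pos i j + t))) L)" if "\<tau> < k" for \<tau>
      by (rule cell_decodes(2)[of L "\<lambda>t. w ! (pos i j + t)" k o']; fact)
    have t': "L - 1 < L" using L(1) by simp
    obtain a' where a': "horner (\<lambda>t. a_digit (w ! (pos i j + t))) L = 10 * a'"
      "List.map_filter emit (map (\<lambda>t. w ! (pos i j + t)) [0..<L]) =
        encode_int a' @ (if Suc j = n then '';'' else '','')"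
      using cl lc[OF ij t'] by auto
    have aa: "a' = a i j" "horner (\<lambda>t. a_digit (w ! (pos i j + t))) L = 10 * a i j"
      using a'(1) by (simp_all add: a_def)
    have "kind (w ! (pos i j + (L - 1))) = Sep" using sep[OF ij t'] L(1) by simp
    then have "(\<forall>\<tau><k. 0 \<le> vs (w ! (pos i j + (L - 1))) ! \<tau>) \<and> (\<exists>\<tau><k. vs (w ! (pos i j + (L - 1))) ! \<tau> = 0)"
      using ok[OF pos_less[OF ij t']] by (simp add: tile_ok_def)
    moreover have "vs (w ! (pos i j + (L - 1))) ! \<tau> = clamp (b i j \<tau> + c i j \<tau> - 10 * a i j)"
      if "\<tau> < k" for \<tau>
      using cl_vs[OF that] by (simp add: horner_add_diff b_def c_def aa(2))
    ultimately have "(\<forall>\<tau><k. 0 \<le> clamp (b i j \<tau> + c i j \<tau> - 10 * a i j)) \<and>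
        (\<exists>\<tau><k. clamp (b i j \<tau> + c i j \<tau> - 10 * a i j) = 0)"
      by auto
    then show ?thesis using a'(2) aa(1) by (simp add: clamp_nonneg_iff clamp_eq_0_iff)
  qed
  have b_eq: "b i j \<tau> = b i 0 \<tau>" if "i < m" "j < n" for i j \<tau>
    using that(2)
  proof (induction j)
    case (Suc j)
    have "bs (w ! (pos i (Suc j) + t)) = bs (w ! (pos i j + t))" if "t < L" for t
    proof -
      have e: "pos i (Suc j) + t = pos i j + t + L" by (simp add: pos_def)
      then have "pos i j + t + L < N" using pos_less[OF \<open>i < m\<close> Suc.prems that] by simp
      \<comment> \<open>The exemption does not apply: column \<open>j\<close> is not the last one,
        since \<open>Suc j < n\<close>.\<close>
      then show ?thesis
        using bs_eq[of "pos i j + t"] lc[of i j t] \<open>i < m\<close> Suc.prems that unfolding e by auto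
    qed
    then have "b i (Suc j) \<tau> = b i j \<tau>" unfolding b_def by (intro horner_cong) simp
    then show ?case using Suc by simp
  qed simp
  have c_eq: "c i j \<tau> = c 0 j \<tau>" if "i < m" "j < n" for i j \<tau>
    using that(1)
  proof (induction i)
    case (Suc i)
    have "cs (w ! (pos (Suc i) j + t)) = cs (w ! (pos i j + t))" if "t < L" for t
    proof -
      have e: "pos (Suc i) j + t = pos i j + t + R" by (simp add: pos_def)
      then have "pos i j + t + R < N" using pos_less[OF Suc.prems \<open>j < n\<close> that] by simp
      then show ?thesis using cs_eq[of "pos i j + t"] unfolding e by simp
    qed
    then have "c (Suc i) j \<tau> = c i j \<tau>" unfolding c_def by (intro horner_cong) simp
    then show ?case using Suc by simp
  qed simp
  define A where "A = mat m n (\<lambda>(i, j). a i j)"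
  have "w = map ((!) w) [0..<m * R]"
    by (rule nth_equalityI) (auto simp: N_def [symmetric] m)
  also have "\<dots> = concat (map (\<lambda>i. concat (map (\<lambda>j. map (\<lambda>t. w ! (pos i j + t)) [0..<L]) [0..<n])) [0..<m])"
    by (simp only: n map_upt_mult pos_def add.assoc)
  finally have "List.map_filter emit w = List.map_filter emit (concat (map (\<lambda>i.
      concat (map (\<lambda>j. map (\<lambda>t. w ! (pos i j + t)) [0..<L]) [0..<n])) [0..<m]))"
    by (rule arg_cong)
  also have "\<dots> = concat (map (\<lambda>i. concat (map (\<lambda>j.
      List.map_filter emit (map (\<lambda>t. w ! (pos i j + t)) [0..<L])) [0..<n])) [0..<m])"
    by (simp only: map_filter_concat map_map comp_def)
  also have "\<dots> = encode_matrix A"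
    unfolding encode_matrix_def
    by (intro arg_cong[of _ _ concat] map_cong) (auto simp: A_def cell_facts simp del: map_map)
  finally have "List.map_filter emit w = encode_matrix A" .
  moreover have "has_trop_factorization k A"
    unfolding has_trop_factorization_iff[OF \<open>0 < k\<close>]
  proof (intro exI allI impI)
    fix i j assume "i < dim_row A" "j < dim_col A"
    then have ij: "i < m" "j < n" by (auto simp: A_def)
    have Aij: "A $$ (i, j) = a i j" using ij by (simp add: A_def)
    have "(\<forall>\<tau><k. 10 * a i j \<le> b i 0 \<tau> + c 0 j \<tau>) \<and> (\<exists>\<tau><k. b i 0 \<tau> + c 0 j \<tau> = 10 * a i j)"
      using cell_facts[OF ij] b_eq[OF ij] c_eq[OF ij] by simp
    \<comment> \<open>The factors read off need not be divisible by ten; dividing gives real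
      solutions.\<close>
    moreover have "10 * a i j \<le> b i 0 \<tau> + c 0 j \<tau> \<longleftrightarrow>
        real_of_int (a i j) \<le> real_of_int (b i 0 \<tau>) / 10 + real_of_int (c 0 j \<tau>) / 10"
      "b i 0 \<tau> + c 0 j \<tau> = 10 * a i j \<longleftrightarrow>
        real_of_int (b i 0 \<tau>) / 10 + real_of_int (c 0 j \<tau>) / 10 = real_of_int (a i j)" for \<tau>
      by linarith+
    ultimately show "(\<forall>\<tau><k. real_of_int (A $$ (i, j)) \<le>
          real_of_int (b i 0 \<tau>) / 10 + real_of_int (c 0 j \<tau>) / 10) \<and>
        (\<exists>\<tau><k. real_of_int (b i 0 \<tau>) / 10 + real_of_int (c 0 j \<tau>) / 10 = real_of_int (A $$ (i, j)))"
      unfolding Aij by simp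
  qed
  moreover have "0 < dim_row A" "0 < dim_col A" using mn by (simp_all add: A_def)
  ultimately show ?thesis unfolding TMF_def by blast
qed

section \<open>Short solutions\<close>

text \<open>
  The witness \<open>f t\<close> counts the integers below \<open>t\<close> that lie at distance less than \<open>M\<close> above some
  element of \<open>X\<close>.
\<close>

lemma compress_gaps:
  fixes X :: "int set" and M :: nat
  assumes "finite X"
  obtains f :: "int \<Rightarrow> int" where "\<And>t. 0 \<le> f t \<and> f t \<le> int (card X * M)"
    and "\<And>y z. y \<in> X \<Longrightarrow> y \<le> z \<Longrightarrow> z - y \<le> int M \<Longrightarrow> f z - f y = z - y"
    and "\<And>y z. y \<in> X \<Longrightarrow> y \<le> z \<Longrightarrow> int M \<le> z - y \<Longrightarrow> int M \<le> f z - f y"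
proof -
  define C where "C = (\<Union>y\<in>X. {y..<y + int M})"
  define f where "f t = int (card {s \<in> C. s < t})" for t
  have fin: "finite C" using assms by (simp add: C_def)
  have "card C \<le> (\<Sum>y\<in>X. card {y..<y + int M})"
    unfolding C_def by (rule card_UN_le[OF assms])
  then have "card C \<le> card X * M" by simp
  moreover have "card {s \<in> C. s < t} \<le> card C" for t
    using fin by (intro card_mono) auto
  ultimately have bound: "0 \<le> f t \<and> f t \<le> int (card X * M)" for t
    unfolding f_def by (meson le_trans of_nat_0_le_iff of_nat_le_iff)
  have diff: "f z - f y = int (card (C \<inter> {y..<z}))" if "y \<le> z" for y z
  proof -
    have "{s \<in> C. s < z} = {s \<in> C. s < y} \<union> (C \<inter> {y..<z})" using that by auto
    moreover have "card ({s \<in> C. s < y} \<union> (C \<inter> {y..<z})) = card {s \<in> C. s < y} + card (C \<inter> {y..<z})"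
      using fin by (intro card_Un_disjoint) auto
    ultimately show ?thesis by (simp add: f_def)
  qed
  show ?thesis
  proof (rule that[of f, OF bound])
    fix y z assume y: "y \<in> X" "y \<le> z" "z - y \<le> int M"
    then have "C \<inter> {y..<z} = {y..<z}" unfolding C_def by force
    then show "f z - f y = z - y" using diff[OF y(2)] y(2) by simp
  next
    fix y z assume y: "y \<in> X" "y \<le> z" "int M \<le> z - y"
    then have "{y..<y + int M} \<subseteq> C \<inter> {y..<z}" unfolding C_def by auto
    from card_mono[OF _ this] show "int M \<le> f z - f y" using diff[OF y(2)] fin by simp
  qed
qed

text \<open>With \<open>B\<close> and \<open>D\<close> the floors of \<open>b\<close> and
  \<open>- c\<close>, the conditions compare the differences \<open>B - D\<close> with integers of
  size at most \<open>M\<close>. Gap compression preserves differences up to \<open>M\<close> and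
  keeps larger ones at least \<open>M\<close>, so all comparisons survive.\<close>

lemma bounded_integral_factors:
  fixes a :: "nat \<Rightarrow> nat \<Rightarrow> int" and b c :: "nat \<Rightarrow> nat \<Rightarrow> real"
  assumes fact: "\<And>i j. i < m \<Longrightarrow> j < n \<Longrightarrow>
      (\<forall>\<tau><k. real_of_int (a i j) \<le> b i \<tau> + c \<tau> j) \<and> (\<exists>\<tau><k. b i \<tau> + c \<tau> j = real_of_int (a i j))"
    and a: "\<And>i j. i < m \<Longrightarrow> j < n \<Longrightarrow> \<bar>a i j\<bar> \<le> int M"
  obtains b' c' :: "nat \<Rightarrow> nat \<Rightarrow> int" where
    "\<And>i j. i < m \<Longrightarrow> j < n \<Longrightarrow> (\<forall>\<tau><k. a i j \<le> b' i \<tau> + c' \<tau> j) \<and> (\<exists>\<tau><k. b' i \<tau> + c' \<tau> j = a i j)"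
    "\<And>i \<tau>. \<bar>b' i \<tau>\<bar> \<le> int ((m * k + k * n) * M)" "\<And>\<tau> j. \<bar>c' \<tau> j\<bar> \<le> int ((m * k + k * n) * M)"
proof -
  define B where "B i \<tau> = \<lfloor>b i \<tau>\<rfloor>" for i \<tau>
  \<comment> \<open>Flooring \<open>- c\<close> rounds both sides of \<open>a - c \<le> b\<close> in
    the same direction, and floors commute with adding the integer \<open>a i j\<close>.\<close>
  define D where "D \<tau> j = \<lfloor>- c \<tau> j\<rfloor>" for \<tau> j
  define X where "X = (\<lambda>(i, \<tau>). B i \<tau>) ` ({..<m} \<times> {..<k}) \<union> (\<lambda>(\<tau>, j). D \<tau> j) ` ({..<k} \<times> {..<n})"
  have X: "finite X" by (simp add: X_def)
  have "card X \<le> card ((\<lambda>(i, \<tau>). B i \<tau>) ` ({..<m} \<times> {..<k})) + card ((\<lambda>(\<tau>, j). D \<tau> j) ` ({..<k} \<times> {..<n}))"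
    unfolding X_def by (rule card_Un_le)
  also have "\<dots> \<le> card ({..<m} \<times> {..<k}) + card ({..<k} \<times> {..<n})"
    by (intro add_mono card_image_le) auto
  finally have "card X \<le> m * k + k * n" by (simp add: card_cartesian_product)
  then have cardX: "int (card X * M) \<le> int ((m * k + k * n) * M)"
    by (simp only: of_nat_le_iff mult_le_mono1)
  obtain f where f: "\<And>t. 0 \<le> f t \<and> f t \<le> int (card X * M)"
    "\<And>y z. y \<in> X \<Longrightarrow> y \<le> z \<Longrightarrow> z - y \<le> int M \<Longrightarrow> f z - f y = z - y"
    "\<And>y z. y \<in> X \<Longrightarrow> y \<le> z \<Longrightarrow> int M \<le> z - y \<Longrightarrow> int M \<le> f z - f y"
    using compress_gaps[OF X] by metis
  \<comment> \<open>For \<open>z \<le> y\<close> the gap is either preserved or still at least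
    \<open>M\<close>. For \<open>y < z\<close>, \<open>v \<le> y - z\<close> bounds the gap by
    \<open>M\<close>, so it is preserved.\<close>
  have le: "v \<le> f y - f z" if "y \<in> X" "z \<in> X" "v \<le> y - z" "\<bar>v\<bar> \<le> int M" for y z v
  proof (cases "z \<le> y")
    case True
    then show ?thesis using f(2,3)[OF that(2) True] that(3,4) by linarith
  next
    case False
    then show ?thesis using f(2)[OF that(1), of z] that(3,4) by linarith
  qed
  have eq: "f y - f z = y - z" if "y \<in> X" "z \<in> X" "\<bar>y - z\<bar> \<le> int M" for y z
    using f(2)[of y z] f(2)[of z y] that by linarith
  show ?thesis
  proof (rule that[of "\<lambda>i \<tau>. f (B i \<tau>)" "\<lambda>\<tau> j. - f (D \<tau> j)"])
    fix i j assume ij: "i < m" "j < n"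
    have mem: "B i \<tau> \<in> X" "D \<tau> j \<in> X" if "\<tau> < k" for \<tau>
      using ij that by (auto simp: X_def)
    have "a i j \<le> B i \<tau> - D \<tau> j" if "\<tau> < k" for \<tau>
    proof -
      have "real_of_int (a i j) + - c \<tau> j \<le> b i \<tau>" using fact[OF ij] that by fastforce
      then have "\<lfloor>real_of_int (a i j) + - c \<tau> j\<rfloor> \<le> \<lfloor>b i \<tau>\<rfloor>" by (rule floor_mono)
      then show ?thesis unfolding B_def D_def int_add_floor [symmetric] by simp
    qed
    then have "a i j \<le> f (B i \<tau>) + - f (D \<tau> j)" if "\<tau> < k" for \<tau>
      using le[OF mem[OF that] _ a[OF ij]] that by simp
    moreover obtain \<tau> where \<tau>: "\<tau> < k" "b i \<tau> = real_of_int (a i j) + - c \<tau> j"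
      using fact[OF ij] by (metis add_diff_cancel_right' diff_conv_add_uminus)
    have "B i \<tau> - D \<tau> j = a i j"
      unfolding B_def D_def \<tau>(2) int_add_floor [symmetric] by simp
    then have "f (B i \<tau>) + - f (D \<tau> j) = a i j"
      using eq[OF mem[OF \<tau>(1)]] a[OF ij] by simp
    ultimately show "(\<forall>\<tau><k. a i j \<le> f (B i \<tau>) + - f (D \<tau> j)) \<and> (\<exists>\<tau><k. f (B i \<tau>) + - f (D \<tau> j) = a i j)"
      using \<tau>(1) by blast
  qed (use f(1) cardX in \<open>auto intro: order_trans\<close>)
qed

section \<open>Writing down a certificate\<close>

text \<open>Meant for \<open>v = 10 * a\<close> written with \<open>L\<close> digits: the leading
  digit is 0 and gives its place to the sign, the units digit is 0 and gives its place to
  \<open>Sep\<close>. While the prefix \<open>q\<close> vanishes, there are only leading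
  zeros.\<close>

definition padded_kind :: "int \<Rightarrow> nat \<Rightarrow> nat \<Rightarrow> kind" where
  "padded_kind v L t =
     (if t = 0 then Sgn else if Suc t = L then Sep
      else let q = nat \<bar>v\<bar> div 10 ^ (L - Suc t) in
        if q = 0 then (if Suc (Suc t) = L then Zero else Pad) else Dig (q mod 10))"

lemma padded_kind_Sep: "2 \<le> L \<Longrightarrow> padded_kind v L t = Sep \<longleftrightarrow> Suc t = L"
  by (auto simp: padded_kind_def Let_def)

lemma padded_kind_Zero:
  assumes "padded_kind (10 * a) L t = Zero"
  shows "a = 0"
proof -
  have "Suc (Suc t) = L" "nat \<bar>10 * a\<bar> div 10 ^ (L - Suc t) = 0"
    using assms by (auto simp: padded_kind_def Let_def split: if_splits)
  then have "nat \<bar>10 * a\<bar> div 10 = 0" by auto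
  then show ?thesis by (auto simp: div_eq_0_iff)
qed

lemma padded_kind_cases: "padded_kind v L t \<in> {Sgn, Pad, Zero, Sep} \<union> Dig ` {..<10}"
  by (simp add: padded_kind_def Let_def)

lemma padded_kind_link:
  assumes "Suc t < L" "3 \<le> L" "nat \<bar>v\<bar> < 10 ^ (L - 1)"
  shows "kind_link (padded_kind v L t) (padded_kind v L (Suc t))"
proof -
  define q where "q = nat \<bar>v\<bar> div 10 ^ (L - Suc (Suc t))"
  have "L - Suc t = Suc (L - Suc (Suc t))" using assms by simp
  then have q: "nat \<bar>v\<bar> div 10 ^ (L - Suc t) = q div 10"
    unfolding q_def by (simp only: power_Suc2 div_mult2_eq)
  show ?thesis
  proof (cases "t = 0")
    case True
    \<comment> \<open>The leading digit is 0, so \<open>q\<close> is a single digit; as a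
      \<open>Dig\<close> it is nonzero and may follow the sign.\<close>
    have "q div 10 = 0" using q True assms(3) by simp
    then have "q mod 10 = q" by presburger
    then show ?thesis
      using True assms by (auto simp: padded_kind_def Let_def q_def [unfolded True, symmetric])
  next
    case False
    then show ?thesis
      using assms(1) by (auto simp: padded_kind_def Let_def q q_def [symmetric])
  qed
qed

lemma a_digit_padded:
  assumes "t < L" "nat \<bar>10 * a\<bar> < 10 ^ (L - 1)"
  shows "a_digit (Tile (padded_kind (10 * a) L t) (a < 0) l c r b c' v) = signed_digit (10 * a) L t"
proof -
  consider "t = 0" | "t \<noteq> 0" "Suc t = L" | "t \<noteq> 0" "Suc t < L" using assms by linarith
  then show ?thesis
  proof cases
    case 1
    then show ?thesis using assms by (simp add: padded_kind_def signed_digit_def)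
  next
    case 2
    then have "nat \<bar>10 * a\<bar> mod 10 = 0" by (simp add: nat_mult_distrib abs_mult)
    then show ?thesis using 2 by (auto simp: padded_kind_def signed_digit_def)
  next
    case 3
    define q where "q = nat \<bar>10 * a\<bar> div 10 ^ (L - Suc t)"
    have "padded_kind (10 * a) L t =
        (if q = 0 then (if Suc (Suc t) = L then Zero else Pad) else Dig (q mod 10))"
      using 3 by (simp add: padded_kind_def q_def Let_def)
    moreover have "signed_digit (10 * a) L t = sgn (10 * a) * int (q mod 10)"
      by (simp add: signed_digit_def q_def)
    moreover have "q = 0" if "a = 0" using that by (simp add: q_def)
    ultimately show ?thesis
      by (cases a "0 :: int" rule: linorder_cases) (auto simp: sgn_mult)
  qed
qed

lemma less_10_power: "n < 10 ^ n"
  by (induction n) auto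

lemma decimal_less: "n < 10 ^ length (decimal n)"
proof (induction n rule: decimal.induct)
  case (1 n)
  show ?case
  proof (cases "n < 10")
    case True
    then show ?thesis by (simp add: decimal.simps[of n])
  next
    case False
    then have "n div 10 < 10 ^ length (decimal (n div 10))" using 1 by blast
    then have "n < 10 ^ Suc (length (decimal (n div 10)))" by simp
    then show ?thesis using False by (simp add: decimal.simps[of n])
  qed
qed

text \<open>The decimal digits of each entry are part of the encoding, so the input length bounds
  the number of digits.\<close>

lemma encode_matrix_bound:
  assumes "i < dim_row A" "j < dim_col A"
  shows "nat \<bar>A $$ (i, j)\<bar> < 10 ^ length (encode_matrix A)"
proof -
  have le: "length ys \<le> length (concat yss)" if "ys \<in> set yss" for ys :: "string" and yss
    using that by (induction yss) auto
  let ?e = "\<lambda>i j. encode_int (A $$ (i, j)) @ (if Suc j = dim_col A then '';'' else '','')"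
  have "length (decimal (nat \<bar>A $$ (i, j)\<bar>)) \<le> length (?e i j)"
    by (simp add: encode_int_def)
  also have "\<dots> \<le> length (concat (map (?e i) [0..<dim_col A]))"
    using assms by (intro le) auto
  also have "\<dots> \<le> length (encode_matrix A)"
    unfolding encode_matrix_def using assms by (intro le) auto
  finally have "(10 :: nat) ^ length (decimal (nat \<bar>A $$ (i, j)\<bar>)) \<le> 10 ^ length (encode_matrix A)"
    by (rule power_increasing) simp
  then show ?thesis using decimal_less by (rule less_le_trans [rotated])
qed

text \<open>A bounded integral solution has entries with polynomially many digits; ten times these
  integers, written into cells of equal width, form the certificate.\<close>

lemma TMF_imp_locally_valid:
  assumes "0 < k" and "x \<in> TMF k"
  shows "\<exists>w d e. set w \<subseteq> tiles k \<and> locally_valid (constraint k) w d e \<and>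
    List.map_filter emit w = x \<and> length w \<le> poly [:0, 3, 2 * k + 1:] (length x) \<and>
    d \<le> length w \<and> e \<le> length w"
proof -
  obtain A where A: "x = encode_matrix A" "0 < dim_row A" "0 < dim_col A" "has_trop_factorization k A"
    using assms by (auto simp: TMF_def)
  define m where "m = dim_row A"
  define n where "n = dim_col A"
  define l where "l = length x"
  \<comment> \<open>The solution is bounded by \<open>(m * k + k * n) * 10 ^ l\<close>, whose first
    factor is at most \<open>2 * k * l < 10 ^ (2 * k * l)\<close>. The 3 leaves room for the factor
    ten and the sign, and is the least width of a cell.\<close>
  define L where "L = 3 + l + 2 * k * l"
  have mn: "0 < m" "0 < n" using A by (simp_all add: m_def n_def)
  \<comment> \<open>Sign, separator and at least one digit: every entry takes at least three
    symbols.\<close>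
  have "3 * (m * n) \<le> l" using length_encode_matrix[of A] by (simp add: A(1) l_def m_def n_def)
  moreover have "m \<le> m * n" "n \<le> m * n" using mn by simp_all
  ultimately have l: "m * n \<le> l" "m \<le> l" "n \<le> l" by linarith+
  define a where "a i j = A $$ (i, j)" for i j
  have a_bound: "nat \<bar>a i j\<bar> < 10 ^ l" if "i < m" "j < n" for i j
    using encode_matrix_bound[of i A j] that by (simp add: a_def m_def n_def l_def A(1))
  obtain b c :: "nat \<Rightarrow> nat \<Rightarrow> real" where "\<forall>i<m. \<forall>j<n. (\<forall>\<tau><k. real_of_int (a i j) \<le> b i \<tau> + c \<tau> j) \<and>
      (\<exists>\<tau><k. b i \<tau> + c \<tau> j = real_of_int (a i j))"
    using A(4) unfolding has_trop_factorization_iff[OF \<open>0 < k\<close>] m_def n_def a_def by (elim exE)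
  then have bc: "(\<forall>\<tau><k. real_of_int (a i j) \<le> b i \<tau> + c \<tau> j) \<and>
      (\<exists>\<tau><k. b i \<tau> + c \<tau> j = real_of_int (a i j))" if "i < m" "j < n" for i j
    using that by blast
  have "\<bar>a i j\<bar> \<le> int (10 ^ l)" if "i < m" "j < n" for i j
    using a_bound[OF that] by linarith
  then obtain B C :: "nat \<Rightarrow> nat \<Rightarrow> int" where BC:
    "\<And>i j. i < m \<Longrightarrow> j < n \<Longrightarrow> (\<forall>\<tau><k. a i j \<le> B i \<tau> + C \<tau> j) \<and> (\<exists>\<tau><k. B i \<tau> + C \<tau> j = a i j)"
    "\<And>i \<tau>. \<bar>B i \<tau>\<bar> \<le> int ((m * k + k * n) * 10 ^ l)" "\<And>\<tau> j. \<bar>C \<tau> j\<bar> \<le> int ((m * k + k * n) * 10 ^ l)"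
    using bounded_integral_factors[of m n k a b c "10 ^ l", OF bc] by metis
  have "m * k + k * n \<le> l * k + k * l"
    using l by (intro add_mono mult_le_mono) auto
  also have "\<dots> = 2 * k * l" by simp
  also have "\<dots> < 10 ^ (2 * k * l)" by (rule less_10_power)
  finally have "(m * k + k * n) * 10 ^ l < 10 ^ (2 * k * l) * 10 ^ l" by simp
  moreover have "(10 :: nat) ^ L = 1000 * (10 ^ (2 * k * l) * 10 ^ l)"
    by (simp add: L_def power_add)
  ultimately have factor_bound: "10 * ((m * k + k * n) * 10 ^ l) < 10 ^ L" by linarith
  have B_bound: "nat \<bar>10 * B i \<tau>\<bar> < 10 ^ L" and C_bound: "nat \<bar>10 * C \<tau> i\<bar> < 10 ^ L" for i \<tau>
    using BC(2)[of i \<tau>] BC(3)[of \<tau> i] factor_bound by linarith+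
  have "(10 :: nat) ^ Suc l \<le> 10 ^ (L - 1)"
    by (rule power_increasing) (auto simp: L_def)
  then have a_bound': "nat \<bar>10 * a i j\<bar> < 10 ^ (L - 1)" if "i < m" "j < n" for i j
  proof -
    have "nat \<bar>10 * a i j\<bar> = 10 * nat \<bar>a i j\<bar>" by (simp add: abs_mult nat_mult_distrib)
    then show ?thesis
      using a_bound[OF that] \<open>10 ^ Suc l \<le> 10 ^ (L - 1)\<close> unfolding power_Suc by linarith
  qed
  have "(10 :: nat) ^ (L - 1) \<le> 10 ^ L" by (rule power_increasing) auto
  then have a_bound'': "nat \<bar>10 * a i j\<bar> < 10 ^ L" if "i < m" "j < n" for i j
    using a_bound'[OF that] by linarith
  have L: "3 \<le> L" by (simp add: L_def)
  \<comment> \<open>Tile \<open>t\<close> of cell \<open>q\<close>, with cells numbered row by row: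
    the neighbours are \<open>q - 1\<close> and \<open>q - n\<close>. Here \<open>vs\<close> clamps
    the exact Horner value once, which \<open>clamp_horner_step\<close> reconciles with the stepwise
    rule of \<open>link\<close>.\<close>
  define T where "T q t = (let i = q div n; j = q mod n in
    Tile (padded_kind (10 * a i j) L t) (a i j < 0) (Suc j = n) (q = 0) (i = 0)
      (map (\<lambda>\<tau>. signed_digit (10 * B i \<tau>) L t) [0..<k]) (map (\<lambda>\<tau>. signed_digit (10 * C \<tau> j) L t) [0..<k])
      (map (\<lambda>\<tau>. clamp (horner (\<lambda>s. signed_digit (10 * B i \<tau>) L s + signed_digit (10 * C \<tau> j) L s
         - signed_digit (10 * a i j) L s) (Suc t))) [0..<k]))" for q t
  have T_sel: "kind (T q t) = padded_kind (10 * a (q div n) (q mod n)) L t"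
    "neg (T q t) \<longleftrightarrow> a (q div n) (q mod n) < 0"
    "last_col (T q t) \<longleftrightarrow> Suc (q mod n) = n" "first_cell (T q t) \<longleftrightarrow> q = 0"
    "first_row (T q t) \<longleftrightarrow> q div n = 0"
    "bs (T q t) = map (\<lambda>\<tau>. signed_digit (10 * B (q div n) \<tau>) L t) [0..<k]"
    "cs (T q t) = map (\<lambda>\<tau>. signed_digit (10 * C \<tau> (q mod n)) L t) [0..<k]"
    "vs (T q t) = map (\<lambda>\<tau>. clamp (horner (\<lambda>s. signed_digit (10 * B (q div n) \<tau>) L s +
       signed_digit (10 * C \<tau> (q mod n)) L s - signed_digit (10 * a (q div n) (q mod n)) L s) (Suc t))) [0..<k]"
    for q t
    by (simp_all add: T_def Let_def)
  have ij: "q div n < m" "q mod n < n" if "q < m * n" for q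
    using that mn by (simp_all add: less_mult_imp_div_less)
  have T_digit: "a_digit (T q t) = signed_digit (10 * a (q div n) (q mod n)) L t"
    if "q < m * n" "t < L" for q t
    unfolding T_def Let_def by (rule a_digit_padded[OF that(2) a_bound'[OF ij[OF that(1)]]])
  have T_tiles: "T q t \<in> tiles k" for q t
    unfolding mem_tiles T_sel using padded_kind_cases signed_digit_bound clamp_bound by auto
  have T_Sep: "kind (T q t) = Sep \<longleftrightarrow> Suc t = L" for q t
    using L by (simp add: T_sel padded_kind_Sep)
  have link_Suc: "link k (Some (T q t)) (T q (Suc t))" if "q < m * n" "Suc t < L" for q t
  proof -
    have "kind (T q t) \<noteq> Sep" using that by (simp add: T_Sep)
    moreover have "kind_link (kind (T q t)) (kind (T q (Suc t)))"
      unfolding T_sel using that L a_bound'[OF ij[OF that(1)]] by (intro padded_kind_link)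
    moreover have "vs (T q (Suc t)) ! \<tau> =
        clamp (10 * vs (T q t) ! \<tau> + (bs (T q (Suc t)) ! \<tau> + cs (T q (Suc t)) ! \<tau> - a_digit (T q (Suc t))))"
      if "\<tau> < k" for \<tau>
    proof -
      define F where "F s = signed_digit (10 * B (q div n) \<tau>) L s +
        signed_digit (10 * C \<tau> (q mod n)) L s - signed_digit (10 * a (q div n) (q mod n)) L s" for s
      have "vs (T q s) ! \<tau> = clamp (horner F (Suc s))" for s
        using that by (simp add: T_sel F_def [abs_def] del: horner.simps)
      moreover have "bs (T q (Suc t)) ! \<tau> + cs (T q (Suc t)) ! \<tau> - a_digit (T q (Suc t)) = F (Suc t)"
        using that \<open>q < m * n\<close> \<open>Suc t < L\<close> by (simp add: T_sel T_digit F_def)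
      ultimately show ?thesis
        using clamp_horner_step[OF tile_digit_bound[OF T_tiles that, of q "Suc t"]] by simp
    qed
    ultimately show ?thesis by (auto simp: link_def starts_cell_def T_sel(2-5))
  qed
  have vs0: "vs (T q 0) ! \<tau> = clamp (bs (T q 0) ! \<tau> + cs (T q 0) ! \<tau> - a_digit (T q 0))"
    if "q < m * n" "\<tau> < k" for q \<tau>
    using that L by (simp add: T_sel T_digit)
  have link_0: "link k None (T 0 0)"
    using vs0[of 0] mn unfolding link_def starts_cell_def
    by (simp add: T_sel(1-5)) (simp add: padded_kind_def)
  have link_next: "link k (Some (T q t)) (T (Suc q) 0)" if "Suc q < m * n" "Suc t = L" for q t
    using vs0[of "Suc q"] that mn T_Sep[of q t] unfolding link_def starts_cell_def
    by (auto simp: T_sel(2-5) div_Suc mod_Suc) (simp_all add: T_sel(1) padded_kind_def)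
  have ok: "tile_ok k (T q t) (if q = 0 then None else Some (T (q - 1) t))
      (if q < n then None else Some (T (q - n) t))" if q: "q < m * n" and t: "t < L" for q t
    unfolding tile_ok_def
  proof (intro conjI allI impI)
    show "first_cell (T q t) \<longleftrightarrow> (if q = 0 then None else Some (T (q - 1) t)) = None"
      by (simp add: T_sel)
    show "first_row (T q t) \<longleftrightarrow> (if q < n then None else Some (T (q - n) t)) = None"
      using mn by (simp add: T_sel div_eq_0_iff)
  next
    fix u assume "(if q = 0 then None else Some (T (q - 1) t)) = Some u"
    then obtain p where p: "q = Suc p" "u = T p t" by (cases q) auto
    show "kind (T q t) = Sep \<longleftrightarrow> kind u = Sep" by (simp add: p T_Sep)
    \<comment> \<open>Either \<open>u\<close> ends a row and is exempt, or \<open>p\<close> and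
      \<open>Suc p\<close> lie in the same row.\<close>
    show "last_col u \<or> bs (T q t) = bs u" by (auto simp: p T_sel div_Suc mod_Suc)
  next
    fix u assume "(if q < n then None else Some (T (q - n) t)) = Some u"
    then have p: "n \<le> q" "u = T (q - n) t" by (auto split: if_splits)
    show "kind (T q t) = Sep \<and> last_col (T q t) \<longleftrightarrow> kind u = Sep \<and> last_col u"
      using p by (simp add: T_Sep T_sel(3) le_mod_geq)
    show "cs (T q t) = cs u" using p by (simp add: T_sel le_mod_geq)
  next
    assume "kind (T q t) = Zero"
    then show "\<not> neg (T q t)" using padded_kind_Zero[of "a (q div n) (q mod n)" L t] by (auto simp: T_sel)
  next
    assume "kind (T q t) = Sep"
    then have t': "Suc t = L" by (simp add: T_Sep)
    \<comment> \<open>At the separator all \<open>L\<close> digits have been read, so Horner's value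
      is the full difference.\<close>
    have v: "vs (T q t) ! \<tau> = clamp (10 * (B (q div n) \<tau> + C \<tau> (q mod n) - a (q div n) (q mod n)))"
      if "\<tau> < k" for \<tau>
      using that a_bound''[OF ij[OF q]] B_bound C_bound
      by (simp add: T_sel t' horner_add_diff horner_signed_digit algebra_simps del: horner.simps)
    show "0 \<le> vs (T q t) ! \<tau>" if "\<tau> < k" for \<tau>
    proof -
      have "a (q div n) (q mod n) \<le> B (q div n) \<tau> + C \<tau> (q mod n)"
        using BC(1)[OF ij[OF q]] that by blast
      then show ?thesis using that by (simp add: v clamp_nonneg_iff)
    qed
    obtain \<tau> where "\<tau> < k" "B (q div n) \<tau> + C \<tau> (q mod n) = a (q div n) (q mod n)"
      using BC(1)[OF ij[OF q]] by blast
    then show "\<exists>\<tau><k. vs (T q t) ! \<tau> = 0"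
      by (intro exI[of _ \<tau>]) (simp add: v clamp_eq_0_iff)
  qed
  define w where "w = map (\<lambda>p. T (p div L) (p mod L)) [0..<m * n * L]"
  have len: "length w = m * n * L" by (simp add: w_def)
  have w_nth: "w ! (q * L + t) = T q t" if "q * L + t < length w" "t < L" for q t
    using that by (simp add: w_def)
  have "set w \<subseteq> tiles k" using T_tiles by (auto simp: w_def)
  moreover have "locally_valid (constraint k) w L (n * L)"
    unfolding locally_valid_iff
  proof (intro conjI allI impI)
    have "0 < length w" using mn L by (simp add: len)
    then have "letter w 0 = Some (T 0 0)" using w_nth[of 0 0] L by (simp add: letter_def)
    then show "constraint k (letter w 0) None None None"
      using link_0 by (simp add: constraint_def)
  next
    fix p assume p: "p < length w"
    define q t where "q = p div L" and "t = p mod L"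
    have t: "t < L" using L by (simp add: t_def)
    have q: "q < m * n" using p by (simp add: q_def len less_mult_imp_div_less)
    have pq: "p = q * L + t" by (simp add: q_def t_def)
    have wp: "w ! p = T q t" using w_nth[of q t] p t unfolding pq by simp
    have Suc: "if Suc t = L then Suc p = Suc q * L else Suc p = q * L + Suc t" using pq by auto
    have nxt: "case if Suc p < length w then Some (w ! Suc p) else None of
        None \<Rightarrow> Some (T q t) \<noteq> None \<and> kind (the (Some (T q t))) = Sep \<and> last_col (the (Some (T q t)))
      | Some t' \<Rightarrow> link k (Some (T q t)) t'"
    proof (cases "Suc p < length w")
      case True
      show ?thesis
      proof (cases "Suc t = L")
        case t': True
        then have e: "Suc p = Suc q * L + 0" using Suc by simp
        have "w ! Suc p = T (Suc q) 0"
          using w_nth[of "Suc q" 0] True L unfolding e by simp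
        moreover have "Suc q < m * n" using True L unfolding e len by (simp del: mult_Suc)
        ultimately show ?thesis using True link_next t' by simp
      next
        case False
        then have e: "Suc p = q * L + Suc t" and "Suc t < L" using Suc t by auto
        then have "w ! Suc p = T q (Suc t)"
          using w_nth[of q "Suc t"] True unfolding e by simp
        then show ?thesis using True link_Suc[OF q] \<open>Suc t < L\<close> by simp
      qed
    next
      case False
      \<comment> \<open>The last position closes its cell, and cell \<open>m * n - 1\<close> closes
        a row because \<open>n\<close> divides \<open>m * n\<close>.\<close>
      then have e: "Suc p = m * n * L" using p len by simp
      have t': "Suc t = L"
      proof (rule ccontr)
        assume "Suc t \<noteq> L"
        then have "Suc t < L" "Suc p = q * L + Suc t" using t Suc by auto
        then show False using e mult_add_less[OF q, of "Suc t" L] by simp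
      qed
      then have "Suc q * L = m * n * L" using Suc e by simp
      then have "Suc q = m * n" using L by (simp del: mult_Suc)
      then have "Suc q mod n = 0" by simp
      then have "Suc (q mod n) = n" by (simp add: mod_Suc split: if_splits)
      then show ?thesis using False t' T_Sep by (simp add: T_sel(3))
    qed
    have lft: "(if p < L then None else Some (w ! (p - L))) = (if q = 0 then None else Some (T (q - 1) t))"
    proof (cases "p < L")
      case False
      then obtain r where r: "q = Suc r" using t pq by (cases q) auto
      then have "p - L = r * L + t" using pq by simp
      then show ?thesis using False p w_nth[of r t] t r by simp
    qed (simp add: q_def)
    have up: "(if p < n * L then None else Some (w ! (p - n * L))) = (if q < n then None else Some (T (q - n) t))"
    proof (cases "q < n")
      case True
      then show ?thesis using mult_add_less[OF True t] pq by simp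
    next
      case False
      then obtain r where r: "q = n + r" using le_Suc_ex not_less by blast
      then have "p - n * L = r * L + t" "\<not> p < n * L" using pq by (simp_all add: add_mult_distrib)
      then show ?thesis using False p w_nth[of r t] t r by simp
    qed
    show "constraint k (if Suc p < length w then Some (w ! Suc p) else None) (Some (w ! p))
        (if p < L then None else Some (w ! (p - L))) (if p < n * L then None else Some (w ! (p - n * L)))"
      unfolding constraint_def wp lft up using nxt ok[OF q t] by simp
  qed
  moreover have "List.map_filter emit w = x"
  proof -
    have cell: "List.map_filter emit (map (T (i * n + j)) [0..<L]) =
        encode_int (a i j) @ (if Suc j = n then '';'' else '','')" if "i < m" "j < n" for i j
    proof -
      define q where "q = i * n + j"
      have q: "q < m * n" "q div n = i" "q mod n = j"
        using mult_add_less[OF that] that by (simp_all add: q_def)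
      define o' where "o' = (if q = 0 then None else Some (T (q - 1) (L - 1)))"
      have "starts_cell o'" using T_Sep[of "q - 1" "L - 1"] L by (simp add: o'_def starts_cell_def)
      moreover have "link k o' (T q 0)"
        using link_0 link_next[of "q - 1" "L - 1"] q(1) L by (auto simp: o'_def)
      moreover have "\<not> neg (T q t)" if "kind (T q t) = Zero" for t
        using that padded_kind_Zero[of "a (q div n) (q mod n)" L t] by (auto simp: T_sel)
      \<comment> \<open>The decoding lemma for arbitrary cells is reused; Horner's value identifies
        the integer it yields as \<open>a i j\<close>.\<close>
      ultimately obtain a' where "horner (\<lambda>t. a_digit (T q t)) L = 10 * a'"
        "List.map_filter emit (map (T q) [0..<L]) =
          encode_int a' @ (if last_col (T q (L - 1)) then '';'' else '','')"
        using cell_decodes(1)[of L "T q" k o'] L T_tiles link_Suc[OF q(1)] T_Sep by force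
      moreover have "horner (\<lambda>t. a_digit (T q t)) L = 10 * a i j"
        using horner_cong[of L "\<lambda>t. a_digit (T q t)" "signed_digit (10 * a i j) L"]
          T_digit[OF q(1)] q a_bound''[OF that] by (simp add: horner_signed_digit)
      ultimately show ?thesis using q by (simp add: q_def [symmetric] T_sel(3))
    qed
    have div_mod: "(i * (n * L) + (j * L + t)) div L = i * n + j" "(i * (n * L) + (j * L + t)) mod L = t"
      if "t < L" for i j t
    proof -
      have "i * (n * L) + (j * L + t) = t + (i * n + j) * L" by (simp add: algebra_simps)
      then show "(i * (n * L) + (j * L + t)) div L = i * n + j" "(i * (n * L) + (j * L + t)) mod L = t"
        using that by (simp_all only: div_mult_self1 mod_mult_self1) simp_all
    qed
    have "w = map (\<lambda>p. T (p div L) (p mod L)) [0..<m * (n * L)]"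
      by (simp only: w_def mult.assoc)
    also have "\<dots> = concat (map (\<lambda>i. concat (map (\<lambda>j. map (\<lambda>t.
        T ((i * (n * L) + (j * L + t)) div L) ((i * (n * L) + (j * L + t)) mod L)) [0..<L]) [0..<n])) [0..<m])"
      by (simp only: map_upt_mult)
    also have "\<dots> = concat (map (\<lambda>i. concat (map (\<lambda>j. map (T (i * n + j)) [0..<L]) [0..<n])) [0..<m])"
      by (intro arg_cong[of _ _ concat] map_cong) (auto simp only: div_mod set_upt atLeastLessThan_iff)
    finally have "List.map_filter emit w = concat (map (\<lambda>i. concat (map (\<lambda>j.
        List.map_filter emit (map (T (i * n + j)) [0..<L])) [0..<n])) [0..<m])"
      by (simp only: map_filter_concat map_map comp_def)
    also have "\<dots> = x"
      unfolding A(1) encode_matrix_def m_def [symmetric] n_def [symmetric] a_def [symmetric]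
      by (intro arg_cong[of _ _ concat] map_cong) (auto simp: cell simp del: map_map)
    finally show ?thesis .
  qed
  moreover have "length w \<le> poly [:0, 3, 2 * k + 1:] (length x)"
  proof -
    have "length w \<le> l * L" unfolding len using l(1) by (rule mult_le_mono1)
    also have "\<dots> = poly [:0, 3, 2 * k + 1:] (length x)"
      by (simp add: L_def l_def algebra_simps)
    finally show ?thesis .
  qed
  moreover have "L \<le> length w" "n * L \<le> length w" using mn by (simp_all add: len)
  ultimately show ?thesis by blast
qed

theorem theorem2p4:
  fixes k :: nat
  assumes "k > 0"
  shows "TMF k \<in> NP"
  by (rule NP_local_constraints[OF finite_tiles locally_valid_imp_TMF[OF assms]
        TMF_imp_locally_valid[OF assms]])

end
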